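(* Consider the Blaschke product $B$ whose zeros are $\lambda_n=(1-x_n2^{-2n})e^{i2^{-n}}$, $n\ge 1$, where $(x_n)_{n\ge 1}$ is a sequence of positive numbers with $x_n\downarrow 0$ (and $\lambda_n\in\mathbb D$). Set $\sigma_N:=\sum_{n=1}^N x_n$, let $\varphi_0$ be the piecewise affine function with $\varphi_0(N)=\sigma_N$, and let $\varphi$ be defined by $\varphi(y):=\varphi_0\left(\log_2\frac{1}{1-y}\right)$. Then $$\|k^B_z\|\asymp\sqrt{\varphi(|z|)},\qquad z\in\Gamma_{\alpha,1},$$ and so every $f\in(BH^2)^\perp$ satisfies $$|f(z)|\lesssim\sqrt{\varphi(|z|)},\qquad z\in\Gamma_{\alpha,1}.$$
   Context: $\mathbb D=\{|z|<1\}$; $H^2$ is the Hardy space of $\mathbb D$ with its usual norm $\|\cdot\|$, and $(BH^2)^\perp=H^2\ominus BH^2$ is the orthogonal complement of $BH^2$ in $H^2$. The reproducing kernel of $(BH^2)^\perp$ at $\lambda\in\mathbb D$ is $k^B_\lambda(z)=\frac{1-\overline{B(\lambda)}B(z)}{1-\overline{\lambda}z}$, so $\|k^B_\lambda\|^2=\frac{1-|B(\lambda)|^2}{1-|\lambda|^2}$. For $\alpha\in(1,\infty)$ the Stolz domain at $1$ is $\Gamma_{\alpha,1}=\{z\in\mathbb D:\frac{|z-1|}{1-|z|}<\alpha\}$. The notation $u\lesssim v$ means $u\le Cv$ with a constant $C>0$ independent of $z$, and $u\asymp v$ means $u\lesssim v$ and $v\lesssim u$.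
   Formalization: The function φ_0 is taken affine on [0,1] with an arbitrary positive value φ_0(0), since with φ_0(0)=σ_0=0 the comparison fails at z=0, where the kernel norm is positive; for |z|≥1/2 nothing changes. *)

theory Defs
  imports "HOL-Complex_Analysis.Complex_Analysis"
begin

abbreviation unit_disc :: "complex set" where
  "unit_disc \<equiv> ball 0 1"

(* Hardy space of the disc. Elements are total functions of which only the restriction to the
   disc matters; norm and inner product are those of the sequence of Taylor coefficients. *)

definition taylor_coeff :: "(complex \<Rightarrow> complex) \<Rightarrow> nat \<Rightarrow> complex" where
  "taylor_coeff f n = (deriv ^^ n) f 0 / fact n"

definition H2 :: "(complex \<Rightarrow> complex) set" where
  "H2 = {f. f holomorphic_on unit_disc \<and> summable (\<lambda>n. (cmod (taylor_coeff f n))\<^sup>2)}"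

definition H2_inner :: "(complex \<Rightarrow> complex) \<Rightarrow> (complex \<Rightarrow> complex) \<Rightarrow> complex" where
  "H2_inner f g = (\<Sum>n. taylor_coeff f n * cnj (taylor_coeff g n))"

definition H2_norm :: "(complex \<Rightarrow> complex) \<Rightarrow> real" where
  "H2_norm f = sqrt (\<Sum>n. (cmod (taylor_coeff f n))\<^sup>2)"

(* Normalised to be positive at the origin; for a zero at the origin the factor is z. *)
definition blaschke_factor :: "complex \<Rightarrow> complex \<Rightarrow> complex" where
  "blaschke_factor a z =
     (if a = 0 then z else of_real (cmod a) / a * ((a - z) / (1 - cnj a * z)))"

definition blaschke_product :: "(nat \<Rightarrow> complex) \<Rightarrow> complex \<Rightarrow> complex" where
  "blaschke_product a z = (\<Prod>n. blaschke_factor (a n) z)"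

(* The orthogonal complement of B H^2 in H^2. *)
definition model_space :: "(complex \<Rightarrow> complex) \<Rightarrow> (complex \<Rightarrow> complex) set" where
  "model_space B = {f \<in> H2. \<forall>g \<in> H2. H2_inner f (\<lambda>z. B z * g z) = 0}"

definition model_kernel :: "(complex \<Rightarrow> complex) \<Rightarrow> complex \<Rightarrow> complex \<Rightarrow> complex" where
  "model_kernel B w z = (1 - cnj (B w) * B z) / (1 - cnj w * z)"

definition stolz_domain :: "real \<Rightarrow> complex \<Rightarrow> complex set" where
  "stolz_domain \<alpha> \<zeta> = {z \<in> unit_disc. cmod (z - \<zeta>) / (1 - cmod z) < \<alpha>}"

definition lesssim_on :: "'a set \<Rightarrow> ('a \<Rightarrow> real) \<Rightarrow> ('a \<Rightarrow> real) \<Rightarrow> bool" where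
  "lesssim_on S u v \<longleftrightarrow> (\<exists>C>0. \<forall>z\<in>S. u z \<le> C * v z)"

definition comparable_on :: "'a set \<Rightarrow> ('a \<Rightarrow> real) \<Rightarrow> ('a \<Rightarrow> real) \<Rightarrow> bool" where
  "comparable_on S u v \<longleftrightarrow> lesssim_on S u v \<and> lesssim_on S v u"

definition tangential_zero :: "(nat \<Rightarrow> real) \<Rightarrow> nat \<Rightarrow> complex" where
  "tangential_zero x n = of_real (1 - x n / 2 ^ (2 * n)) * exp (\<i> * of_real (1 / 2 ^ n))"

(* The sequence x is indexed from 1; its value at 0 plays no role. *)
definition tangential_blaschke :: "(nat \<Rightarrow> real) \<Rightarrow> complex \<Rightarrow> complex" where
  "tangential_blaschke x = blaschke_product (\<lambda>n. tangential_zero x (Suc n))"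

(* Affine on every [N, N+1] with N a natural number, with prescribed values at N = 1, 2, ...
   The value at 0 is left free: the partial sums start at N = 1, and the empty sum 0 would make
   the comparison with the kernel norm, which is positive at the origin, fail there. *)
definition affine_interpolation :: "(real \<Rightarrow> real) \<Rightarrow> (nat \<Rightarrow> real) \<Rightarrow> bool" where
  "affine_interpolation \<phi>0 \<sigma> \<longleftrightarrow>
     (\<forall>N\<ge>1. \<phi>0 (real N) = \<sigma> N) \<and>
     (\<forall>N::nat. \<exists>a b. \<forall>t\<in>{real N..real N + 1}. \<phi>0 t = a + b * t)"

end

(* Szego kernels reproduce point values, and multiplication by B is isometric on H^2, so the kernel
   of (B H^2)^perp at z has squared norm (1 - |B(z)|^2) / (1 - |z|^2).  Since 1 - |B(z)|^2 is
   1 - prod (1 - v_n) with v_n = (1 - |z|^2) (1 - |l_n|^2) / |1 - cnj l_n z|^2, it is comparable with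
   sum v_n as long as this sum stays bounded.  For z in the Stolz domain |1 - cnj l_n z| is comparable
   with max (1 - |z|) (2^-n), while 1 - |l_n|^2 is comparable with x_n 4^-n.  At scale
   1 - |z| ~ 2^-N the terms with n <= N therefore contribute x_n each, and the rest form a geometric
   tail bounded by a multiple of x_1. *)
theory Submission
  imports Defs
begin

section \<open>Taylor coefficients\<close>

text \<open>Norms in \<open>H2\<close> are norms of coefficient sequences, so the isometry cannot be
  read off |B| = 1 on the circle. For one factor it becomes a telescoping identity between
  coefficients. Limits of products then only give lower semicontinuity of the norm. The sum of the
  v_n stays bounded although \<sigma>_N may tend to infinity: at scale 2^-N it is at most a multiple
  of 2^-N \<sigma>_N \<le> N 2^-N x_1. Only the lower bound needs this. Two boundary cases shape the
  constants. Lying in the disc only forces x_1 < 8, so the real factor 1 - x_1/4 of the first zero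
  may vanish or be negative. And \<sigma>_0 = 0 cannot bound the kernel norm near the origin, so
  scales start at 1 and the free value \<open>\<phi>0 0\<close> is measured against x_1.\<close>

lemma taylor_coeff_fps:
  assumes "f has_fps_expansion F"
  shows "taylor_coeff f n = fps_nth F n"
  using fps_nth_fps_expansion[OF assms] by (simp add: taylor_coeff_def)

lemma has_fps_expansion_taylor:
  assumes "f holomorphic_on unit_disc"
  shows "f has_fps_expansion Abs_fps (taylor_coeff f)"
proof -
  have "f has_fps_expansion fps_expansion f 0"
    by (rule has_fps_expansion_fps_expansion[OF _ _ assms]) auto
  moreover have "fps_expansion f 0 = Abs_fps (taylor_coeff f)"
    by (simp add: fps_expansion_def taylor_coeff_def[abs_def])
  ultimately show ?thesis by simp
qed

lemma taylor_coeff_sums: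
  assumes "f holomorphic_on unit_disc" "z \<in> unit_disc"
  shows "(\<lambda>n. taylor_coeff f n * z ^ n) sums f z"
  using holomorphic_power_series[OF assms] by (simp add: taylor_coeff_def)

lemma taylor_coeff_cmult:
  assumes "f holomorphic_on unit_disc"
  shows "taylor_coeff (\<lambda>z. c * f z) n = c * taylor_coeff f n"
  using taylor_coeff_fps[OF has_fps_expansion_cmult_left[OF has_fps_expansion_taylor[OF assms]]]
  by simp

lemma taylor_coeff_diff:
  assumes "f holomorphic_on unit_disc" "g holomorphic_on unit_disc"
  shows "taylor_coeff (\<lambda>z. f z - g z) n = taylor_coeff f n - taylor_coeff g n"
  using taylor_coeff_fps[OF has_fps_expansion_diff[OF assms[THEN has_fps_expansion_taylor]]]
  by simp

lemma taylor_coeff_cong: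
  assumes "\<And>z. z \<in> unit_disc \<Longrightarrow> f z = g z"
  shows "taylor_coeff f n = taylor_coeff g n"
proof -
  have "eventually (\<lambda>z. f z = g z) (nhds 0)"
    by (rule eventually_mono[OF eventually_nhds_in_open[of unit_disc]]) (auto intro: assms)
  then show ?thesis
    unfolding taylor_coeff_def by (simp add: higher_deriv_cong_ev)
qed

text \<open>Blaschke factors and Szego kernels have denominators \<open>1 - cnj a * z\<close>. For a
  quotient \<open>h\<close> this lemma turns the denominator into a two-term recurrence for its
  coefficients.\<close>

lemma taylor_coeff_linear_mult:
  assumes "h holomorphic_on unit_disc"
  shows "taylor_coeff (\<lambda>z. (c - d * z) * h z) n =
    c * taylor_coeff h n - d * (if n = 0 then 0 else taylor_coeff h (n - 1))"
proof -
  have "(\<lambda>z. (c - d * z) * h z) has_fps_expansion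
      (fps_const c - fps_const d * fps_X) * Abs_fps (taylor_coeff h)"
    by (intro fps_expansion_intros has_fps_expansion_taylor assms)
  then show ?thesis
    by (simp add: taylor_coeff_fps left_diff_distrib mult.assoc)
qed

lemma norm_taylor_coeff_le:
  assumes "f holomorphic_on unit_disc" "\<And>z. cmod z \<le> 1/2 \<Longrightarrow> cmod (f z) \<le> M"
  shows "cmod (taylor_coeff f n) \<le> M * 2 ^ n"
proof -
  have "cball 0 (1/2) \<subseteq> unit_disc"
    by auto
  then have "f holomorphic_on cball 0 (1/2)"
    by (rule holomorphic_on_subset[OF assms(1)])
  then have "continuous_on (cball 0 (1/2)) f" "f holomorphic_on ball 0 (1/2)"
    using holomorphic_on_subset[OF _ ball_subset_cball] holomorphic_on_imp_continuous_on by blast+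
  then have "cmod ((deriv ^^ n) f 0) \<le> fact n * M / (1/2) ^ n"
    by (intro Cauchy_inequality) (auto intro: assms(2))
  then show ?thesis
    by (simp add: taylor_coeff_def norm_divide field_simps power_one_over)
qed

section \<open>The Hardy space\<close>

lemma H2D:
  assumes "f \<in> H2"
  shows "f holomorphic_on unit_disc" "summable (\<lambda>n. (cmod (taylor_coeff f n))\<^sup>2)"
  using assms by (auto simp: H2_def)

lemma H2_norm_nonneg: "f \<in> H2 \<Longrightarrow> 0 \<le> H2_norm f"
  by (simp add: H2_norm_def H2_def suminf_nonneg)

lemma H2_norm_square:
  assumes "f \<in> H2"
  shows "(\<lambda>n. (cmod (taylor_coeff f n))\<^sup>2) sums (H2_norm f)\<^sup>2"
  using H2D(2)[OF assms] by (simp add: H2_norm_def suminf_nonneg summable_sums)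

lemma H2_norm_partial_sum_le:
  assumes "f \<in> H2"
  shows "(\<Sum>n<m. (cmod (taylor_coeff f n))\<^sup>2) \<le> (H2_norm f)\<^sup>2"
  using sum_le_suminf[OF H2D(2)[OF assms], of "{..<m}"] sums_unique[OF H2_norm_square[OF assms]]
  by simp

lemma H2_normI:
  assumes "(\<lambda>n. (cmod (taylor_coeff f n))\<^sup>2) sums s\<^sup>2" "0 \<le> s"
  shows "H2_norm f = s"
  using sums_unique[OF assms(1), symmetric] assms(2) by (simp add: H2_norm_def)

lemma summable_bounded_partial_sums:
  fixes f :: "nat \<Rightarrow> real"
  assumes "\<And>n. 0 \<le> f n" "\<And>n. sum f {..<n} \<le> M"
  shows "summable f" "suminf f \<le> M"
proof -
  show "summable f"
    using assms by (intro summableI_nonneg_bounded) auto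
  then show "suminf f \<le> M"
    using assms(2) by (rule suminf_le_const)
qed

lemma H2_cong:
  assumes "f \<in> H2" "\<And>z. z \<in> unit_disc \<Longrightarrow> f z = g z"
  shows "g \<in> H2" "H2_norm g = H2_norm f"
proof -
  have c: "taylor_coeff g = taylor_coeff f"
    using taylor_coeff_cong[OF assms(2)] by (intro ext) simp
  have "g holomorphic_on unit_disc"
    using H2D(1)[OF assms(1)] by (rule holomorphic_transform) (use assms(2) in auto)
  then show "g \<in> H2" "H2_norm g = H2_norm f"
    using assms(1) by (auto simp: H2_def H2_norm_def c)
qed

lemma H2_cmult:
  assumes "f \<in> H2"
  shows "(\<lambda>z. c * f z) \<in> H2" "H2_norm (\<lambda>z. c * f z) = cmod c * H2_norm f"
proof -
  have c: "taylor_coeff (\<lambda>z. c * f z) n = c * taylor_coeff f n" for n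
    using H2D(1)[OF assms] by (rule taylor_coeff_cmult)
  have s: "(\<lambda>n. (cmod (taylor_coeff (\<lambda>z. c * f z) n))\<^sup>2) sums (cmod c * H2_norm f)\<^sup>2"
    using sums_mult[OF H2_norm_square[OF assms], of "(cmod c)\<^sup>2"]
    by (simp add: c norm_mult power_mult_distrib)
  show "(\<lambda>z. c * f z) \<in> H2"
    using s H2D(1)[OF assms] by (auto simp: H2_def sums_iff intro!: holomorphic_intros)
  show "H2_norm (\<lambda>z. c * f z) = cmod c * H2_norm f"
    by (intro H2_normI[OF s] mult_nonneg_nonneg H2_norm_nonneg assms) auto
qed

text \<open>Each partial sum involves finitely many coefficients, so coefficientwise convergence
  carries the bound over. Mass may escape to high coefficients, hence only an inequality
  survives.\<close>

lemma H2_Fatou: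
  assumes hol: "f holomorphic_on unit_disc" and g: "\<And>k. g k \<in> H2"
    and lim: "\<And>n. (\<lambda>k. taylor_coeff (g k) n) \<longlonglongrightarrow> taylor_coeff f n"
    and bound: "\<And>k. H2_norm (g k) \<le> M"
  shows "f \<in> H2" "H2_norm f \<le> M"
proof -
  have M: "0 \<le> M"
    using bound[of 0] H2_norm_nonneg[OF g[of 0]] by linarith
  have "(\<Sum>n<m. (cmod (taylor_coeff (g k) n))\<^sup>2) \<le> M\<^sup>2" for m k
  proof -
    have "(\<Sum>n<m. (cmod (taylor_coeff (g k) n))\<^sup>2) \<le> (H2_norm (g k))\<^sup>2"
      by (intro H2_norm_partial_sum_le g)
    also have "\<dots> \<le> M\<^sup>2"
      by (intro power_mono bound H2_norm_nonneg g)
    finally show ?thesis .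
  qed
  then have le: "(\<Sum>n<m. (cmod (taylor_coeff f n))\<^sup>2) \<le> M\<^sup>2" for m
    by (intro LIMSEQ_le_const2[where X = "\<lambda>k. \<Sum>n<m. (cmod (taylor_coeff (g k) n))\<^sup>2"])
      (auto intro!: tendsto_intros lim)
  show "f \<in> H2" "H2_norm f \<le> M"
    using summable_bounded_partial_sums[OF _ le] hol M
    by (auto simp: H2_def H2_norm_def intro!: real_le_lsqrt suminf_nonneg)
qed

text \<open>After the triangle inequality this is convexity of the square for the mean of |g| / (1 -
  |a|) and |h| with weights 1 - |a| and |a|. The factor of |h|^2 stays below 1, so that term can
  later be absorbed.\<close>

lemma cmod_add_mult_power2_le:
  fixes g h a :: complex
  assumes "cmod a < 1"
  shows "(cmod (g + a * h))\<^sup>2 \<le> (cmod g)\<^sup>2 / (1 - cmod a) + cmod a * (cmod h)\<^sup>2"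
proof -
  define r G H where "r = cmod a" and "G = cmod g" and "H = cmod h"
  have r: "0 \<le> r" "r < 1" using assms by (auto simp: r_def)
  have "(cmod (g + a * h))\<^sup>2 \<le> (G + r * H)\<^sup>2"
    using norm_triangle_ineq[of g "a * h"]
    by (intro power_mono) (auto simp: norm_mult r_def G_def H_def)
  also have "\<dots> \<le> G\<^sup>2 / (1 - r) + r * H\<^sup>2"
  proof -
    have "(1 - r) * (G\<^sup>2 / (1 - r) + r * H\<^sup>2 - (G + r * H)\<^sup>2) = r * (G - (1 - r) * H)\<^sup>2"
      using r by (simp add: field_simps power2_eq_square)
    moreover have "\<dots> \<ge> 0" using r by simp
    ultimately have "0 \<le> G\<^sup>2 / (1 - r) + r * H\<^sup>2 - (G + r * H)\<^sup>2"
      using r by (metis diff_gt_0_iff_gt zero_le_mult_iff not_less)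
    then show ?thesis by simp
  qed
  finally show ?thesis by (simp add: r_def G_def H_def)
qed

lemma one_minus_cnj_mult_nonzero:
  assumes "cmod a < 1" "cmod z \<le> 1"
  shows "1 - cnj a * z \<noteq> 0"
proof
  assume "1 - cnj a * z = 0"
  then have "cmod a * cmod z = 1"
    by (metis complex_mod_cnj diff_eq_eq diff_zero norm_mult norm_one add_0 eq_iff_diff_eq_0)
  moreover have "cmod a * cmod z \<le> cmod a * 1"
    using assms by (intro mult_left_mono) auto
  ultimately show False using assms by simp
qed

text \<open>The quotient has coefficients h_n = g_n + cnj a h_(n-1). Its partial sums of squares
  therefore bound themselves with the factor |a| < 1; being finite, they can be moved to the other
  side.\<close>

lemma H2_divide_linear:
  assumes g: "g \<in> H2" and a: "cmod a < 1"
  shows "(\<lambda>z. g z / (1 - cnj a * z)) \<in> H2"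
proof -
  define h where "h = (\<lambda>z. g z / (1 - cnj a * z))"
  have hol: "h holomorphic_on unit_disc"
    unfolding h_def using g one_minus_cnj_mult_nonzero[OF a]
    by (intro holomorphic_intros H2D(1)) (auto simp: less_imp_le)
  have rec: "taylor_coeff g n = taylor_coeff h n - cnj a * (if n = 0 then 0 else taylor_coeff h (n - 1))" for n
  proof -
    have "taylor_coeff g n = taylor_coeff (\<lambda>z. (1 - cnj a * z) * h z) n"
      using one_minus_cnj_mult_nonzero[OF a] by (intro taylor_coeff_cong) (auto simp: h_def)
    then show ?thesis using taylor_coeff_linear_mult[OF hol, of 1 "cnj a" n] by simp
  qed
  define r where "r = cmod a"
  define G where "G = (H2_norm g)\<^sup>2"
  have r: "0 \<le> r" "r < 1" using a by (auto simp: r_def)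
  define u where "u n = (cmod (taylor_coeff h n))\<^sup>2" for n
  define v where "v n = (cmod (taylor_coeff g n))\<^sup>2" for n
  have step: "u n \<le> v n / (1 - r) + r * (if n = 0 then 0 else u (n - 1))" for n
    using cmod_add_mult_power2_le[of "cnj a" "taylor_coeff g n" "if n = 0 then 0 else taylor_coeff h (n - 1)"] a rec[of n]
    by (auto simp: u_def v_def r_def split: if_splits)
  have shift: "(\<Sum>n<m. if n = 0 then 0 else u (n - 1)) \<le> sum u {..<m}" for m
  proof (cases m)
    case (Suc k)
    have "(\<Sum>n<Suc k. if n = 0 then 0 else u (n - 1)) = (\<Sum>n<k. u n)"
      by (subst sum.lessThan_Suc_shift) simp
    also have "\<dots> \<le> sum u {..<m}"
      using Suc by (simp add: u_def)
    finally show ?thesis using Suc by simp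
  qed simp
  have "sum u {..<m} \<le> G / (1 - r)\<^sup>2" for m
  proof -
    have "sum u {..<m} \<le> (\<Sum>n<m. v n / (1 - r) + r * (if n = 0 then 0 else u (n - 1)))"
      by (intro sum_mono step)
    also have "\<dots> = sum v {..<m} / (1 - r) + r * (\<Sum>n<m. if n = 0 then 0 else u (n - 1))"
      by (simp add: sum.distrib sum_divide_distrib sum_distrib_left)
    also have "\<dots> \<le> G / (1 - r) + r * sum u {..<m}"
      using r shift H2_norm_partial_sum_le[OF g]
      by (intro add_mono divide_right_mono mult_left_mono) (auto simp: v_def G_def)
    finally have "(1 - r) * sum u {..<m} \<le> G / (1 - r)"
      by (simp add: algebra_simps)
    then have "sum u {..<m} \<le> G / (1 - r) / (1 - r)"
      using r by (subst pos_le_divide_eq) (auto simp: mult.commute)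
    then show ?thesis by (simp add: power2_eq_square)
  qed
  then have "summable u"
    by (rule summable_bounded_partial_sums[rotated]) (auto simp: u_def)
  then show ?thesis
    using hol by (simp add: H2_def u_def[abs_def] h_def)
qed

text \<open>The coefficient form of |a - z| = |1 - cnj a z| on the circle. The squared coefficients
  differ by |a|^2 - 1 times a telescoping difference, whose sum is 0 because the coefficients of
  \<open>h\<close> tend to 0.\<close>

lemma H2_linear_mult:
  assumes h: "h \<in> H2" and g: "(\<lambda>z. (1 - cnj a * z) * h z) \<in> H2"
  shows "(\<lambda>z. (a - z) * h z) \<in> H2"
    "H2_norm (\<lambda>z. (a - z) * h z) = H2_norm (\<lambda>z. (1 - cnj a * z) * h z)"
proof -
  define c where "c = taylor_coeff h"
  define c' where "c' n = (if n = 0 then 0 else c (n - 1))" for n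
  define v where "v n = (cmod (taylor_coeff (\<lambda>z. (1 - cnj a * z) * h z) n))\<^sup>2" for n
  have v: "v n = (cmod (c n - cnj a * c' n))\<^sup>2" for n
    using taylor_coeff_linear_mult[OF H2D(1)[OF h], of 1 "cnj a" n] by (simp add: v_def c_def c'_def)
  define u where "u n = (cmod (taylor_coeff (\<lambda>z. (a - z) * h z) n))\<^sup>2" for n
  have u: "u n = (cmod (a * c n - c' n))\<^sup>2" for n
    using taylor_coeff_linear_mult[OF H2D(1)[OF h], of a 1 n] by (simp add: u_def c_def c'_def)
  have eq: "u n - v n = ((cmod a)\<^sup>2 - 1) * ((cmod (c n))\<^sup>2 - (cmod (c' n))\<^sup>2)" for n
    unfolding u v cmod_power2 by (simp add: algebra_simps power2_eq_square)
  have "summable (\<lambda>n. (cmod (c n))\<^sup>2)"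
    using H2D(2)[OF h] by (simp add: c_def)
  then have "(\<lambda>n. (cmod (c n))\<^sup>2) \<longlonglongrightarrow> 0"
    by (rule summable_LIMSEQ_zero)
  have "(\<lambda>n. (cmod (c n))\<^sup>2 - (cmod (c' n))\<^sup>2) sums 0"
    unfolding sums_def
  proof (rule LIMSEQ_imp_Suc)
    have "(\<Sum>n<Suc m. (cmod (c n))\<^sup>2 - (cmod (c' n))\<^sup>2) = (cmod (c m))\<^sup>2" for m
      by (induction m) (auto simp: c'_def)
    then show "(\<lambda>m. \<Sum>n<Suc m. (cmod (c n))\<^sup>2 - (cmod (c' n))\<^sup>2) \<longlonglongrightarrow> 0"
      using \<open>(\<lambda>n. (cmod (c n))\<^sup>2) \<longlonglongrightarrow> 0\<close> by (simp only:)
  qed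
  from sums_mult[OF this, of "(cmod a)\<^sup>2 - 1"] have "(\<lambda>n. u n - v n) sums 0"
    by (simp add: eq)
  from sums_add[OF this H2_norm_square[OF g, folded v_def]]
  have s: "u sums (H2_norm (\<lambda>z. (1 - cnj a * z) * h z))\<^sup>2" by simp
  have "(\<lambda>z. (a - z) * h z) holomorphic_on unit_disc"
    by (intro holomorphic_intros H2D(1)[OF h])
  with s show "(\<lambda>z. (a - z) * h z) \<in> H2"
    by (simp add: H2_def u_def[abs_def] sums_iff)
  show "H2_norm (\<lambda>z. (a - z) * h z) = H2_norm (\<lambda>z. (1 - cnj a * z) * h z)"
    using s unfolding u_def by (intro H2_normI H2_norm_nonneg g)
qed

section \<open>Blaschke factors\<close>

text \<open>Removes the case distinction: at \<open>a = 0\<close> the unimodular constant is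
  \<open>-1\<close>.\<close>

lemma blaschke_factor_alt:
  obtains u where "cmod u = 1" "\<And>z. blaschke_factor a z = u * ((a - z) / (1 - cnj a * z))"
proof (cases "a = 0")
  case True
  then show ?thesis
    by (intro that[of "-1"]) (auto simp: blaschke_factor_def)
next
  case False
  then show ?thesis
    by (intro that[of "of_real (cmod a) / a"]) (auto simp: blaschke_factor_def norm_divide)
qed

lemma H2_blaschke_factor_mult:
  assumes g: "g \<in> H2" and a: "cmod a < 1"
  shows "(\<lambda>z. blaschke_factor a z * g z) \<in> H2"
    "H2_norm (\<lambda>z. blaschke_factor a z * g z) = H2_norm g"
proof -
  obtain u where u: "cmod u = 1" "\<And>z. blaschke_factor a z = u * ((a - z) / (1 - cnj a * z))"
    using blaschke_factor_alt by blast
  define h where "h = (\<lambda>z. g z / (1 - cnj a * z))"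
  have h: "h \<in> H2"
    unfolding h_def by (intro H2_divide_linear assms)
  have g': "(\<lambda>z. (1 - cnj a * z) * h z) \<in> H2" "H2_norm (\<lambda>z. (1 - cnj a * z) * h z) = H2_norm g"
    using one_minus_cnj_mult_nonzero[OF a]
    by (auto intro!: H2_cong[OF g] simp: h_def less_imp_le)
  have eq: "(\<lambda>z. blaschke_factor a z * g z) = (\<lambda>z. u * ((a - z) * h z))"
    by (auto simp: u h_def)
  show "(\<lambda>z. blaschke_factor a z * g z) \<in> H2"
    "H2_norm (\<lambda>z. blaschke_factor a z * g z) = H2_norm g"
    unfolding eq using H2_linear_mult[OF h g'(1)] g'(2) u(1) by (simp_all add: H2_cmult)
qed

lemma H2_finite_blaschke_mult:
  fixes a :: "nat \<Rightarrow> complex"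
  assumes g: "g \<in> H2" and a: "\<And>n. cmod (a n) < 1"
  shows "(\<lambda>z. (\<Prod>n<k. blaschke_factor (a n) z) * g z) \<in> H2 \<and>
    H2_norm (\<lambda>z. (\<Prod>n<k. blaschke_factor (a n) z) * g z) = H2_norm g"
proof (induction k)
  case (Suc k)
  have "(\<lambda>z. (\<Prod>n<Suc k. blaschke_factor (a n) z) * g z) =
      (\<lambda>z. blaschke_factor (a k) z * ((\<Prod>n<k. blaschke_factor (a n) z) * g z))"
    by (auto simp: mult_ac)
  then show ?case
    using H2_blaschke_factor_mult[OF conjunct1[OF Suc] a[of k]] Suc by simp
qed (use g in simp)

lemma cmod_one_minus_cnj_mult_ge: "1 - cmod a * cmod z \<le> cmod (1 - cnj a * z)"
  using norm_triangle_ineq2[of 1 "cnj a * z"] by (simp add: norm_mult)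

lemma one_minus_blaschke_factor_power2:
  assumes "cmod a < 1" "cmod z < 1"
  shows "1 - (cmod (blaschke_factor a z))\<^sup>2 =
    (1 - (cmod a)\<^sup>2) * (1 - (cmod z)\<^sup>2) / (cmod (1 - cnj a * z))\<^sup>2"
proof -
  obtain u where u: "cmod u = 1" "\<And>z. blaschke_factor a z = u * ((a - z) / (1 - cnj a * z))"
    using blaschke_factor_alt by blast
  have "(cmod (1 - cnj a * z))\<^sup>2 - (cmod (a - z))\<^sup>2 = (1 - (cmod a)\<^sup>2) * (1 - (cmod z)\<^sup>2)"
    unfolding cmod_power2 by (simp add: algebra_simps power2_eq_square)
  moreover have "cmod (1 - cnj a * z) \<noteq> 0"
    using one_minus_cnj_mult_nonzero[of a z] assms by simp
  moreover have "cmod (blaschke_factor a z) = cmod (a - z) / cmod (1 - cnj a * z)"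
    unfolding u by (simp add: norm_mult norm_divide u(1))
  ultimately show ?thesis
    by (metis diff_divide_distrib divide_self power_divide power_not_zero)
qed

lemma cmod_blaschke_factor_le_1:
  assumes "cmod a < 1" "cmod z < 1"
  shows "cmod (blaschke_factor a z) \<le> 1"
proof -
  have "0 \<le> 1 - (cmod (blaschke_factor a z))\<^sup>2"
    using assms unfolding one_minus_blaschke_factor_power2[OF assms]
    by (intro divide_nonneg_nonneg mult_nonneg_nonneg) (auto simp: abs_square_le_1)
  then show ?thesis by (simp add: abs_square_le_1)
qed

text \<open>The normalisation |a| / a matters here: it lets \<open>1 - cmod a\<close> split off from
  the numerator of \<open>blaschke_factor a z - 1\<close>, so the Blaschke condition yields locally
  uniform convergence.\<close>

lemma cmod_blaschke_factor_minus_1_le: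
  assumes "cmod a < 1" "cmod z \<le> r" "r < 1"
  shows "cmod (blaschke_factor a z - 1) \<le> 2 / (1 - r) * (1 - cmod a)"
proof (cases "a = 0")
  case True
  have "cmod (z - 1) \<le> 2" using norm_triangle_ineq4[of z 1] assms by simp
  also have "2 \<le> 2 / (1 - r)"
    using assms norm_ge_zero[of z] by (auto simp: field_simps simp del: norm_ge_zero)
  finally show ?thesis using True by (simp add: blaschke_factor_def)
next
  case False
  have nz: "1 - cnj a * z \<noteq> 0"
    using one_minus_cnj_mult_nonzero assms by simp
  have aa: "a * cnj a = of_real (cmod a) * of_real (cmod a)"
    by (simp add: complex_norm_square[symmetric] power2_eq_square[symmetric])
  have "blaschke_factor a z - 1 =
      (of_real (cmod a) * (a - z) - a * (1 - cnj a * z)) / (a * (1 - cnj a * z))"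
    using nz False by (simp add: blaschke_factor_def field_simps)
  also have "of_real (cmod a) * (a - z) - a * (1 - cnj a * z) =
      of_real (cmod a) * (a - z) - a + (a * cnj a) * z"
    by (simp add: algebra_simps)
  also have "\<dots> = - (of_real (1 - cmod a) * (a + of_real (cmod a) * z))"
    unfolding aa by (simp add: algebra_simps)
  finally have "cmod (blaschke_factor a z - 1) =
      (1 - cmod a) * cmod (a + of_real (cmod a) * z) / (cmod a * cmod (1 - cnj a * z))"
    using assms by (simp add: norm_mult norm_divide del: of_real_diff)
  also have "\<dots> \<le> (1 - cmod a) * (cmod a * 2) / (cmod a * (1 - r))"
  proof -
    have "cmod (a + of_real (cmod a) * z) \<le> cmod a + cmod a * cmod z"
      using norm_triangle_ineq[of a "of_real (cmod a) * z"] by (simp add: norm_mult)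
    also have "\<dots> \<le> cmod a + cmod a * 1" using assms by (intro add_mono mult_left_mono) auto
    finally have 1: "cmod (a + of_real (cmod a) * z) \<le> cmod a * 2" by simp
    have "cmod a * cmod z \<le> 1 * r" using assms by (intro mult_mono) auto
    then have "1 - r \<le> cmod (1 - cnj a * z)"
      using cmod_one_minus_cnj_mult_ge[of a z] by simp
    then have 2: "cmod a * (1 - r) \<le> cmod a * cmod (1 - cnj a * z)"
      by (rule mult_left_mono) simp
    have 3: "(1 - cmod a) * cmod (a + of_real (cmod a) * z) \<le> (1 - cmod a) * (cmod a * 2)"
      using 1 by (rule mult_left_mono) (use assms in simp)
    show ?thesis
      by (rule frac_le[OF _ 3 _ 2]) (use assms False in auto)
  qed
  also have "\<dots> = 2 / (1 - r) * (1 - cmod a)"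
    using False by simp
  finally show ?thesis .
qed

section \<open>Infinite Blaschke products\<close>

definition blaschke_sequence :: "(nat \<Rightarrow> complex) \<Rightarrow> bool" where
  "blaschke_sequence a \<longleftrightarrow> (\<forall>n. cmod (a n) < 1) \<and> summable (\<lambda>n. 1 - cmod (a n))"

lemma blaschke_sequence_shift:
  assumes "blaschke_sequence a"
  shows "blaschke_sequence (\<lambda>n. a (n + k))"
  using assms summable_ignore_initial_segment[of "\<lambda>n. 1 - cmod (a n)" k]
  by (simp add: blaschke_sequence_def)

lemma blaschke_product_convergent:
  assumes a: "blaschke_sequence a" and z: "cmod z < 1"
  shows "convergent_prod (\<lambda>n. blaschke_factor (a n) z)"
proof -
  have "summable (\<lambda>n. cmod (blaschke_factor (a n) z - 1))"
  proof (rule summable_comparison_test')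
    show "summable (\<lambda>n. 2 / (1 - cmod z) * (1 - cmod (a n)))"
      using a by (intro summable_mult) (simp add: blaschke_sequence_def)
    show "norm (cmod (blaschke_factor (a n) z - 1)) \<le> 2 / (1 - cmod z) * (1 - cmod (a n))" for n
      using cmod_blaschke_factor_minus_1_le[of "a n" z "cmod z"] a z
      by (simp add: blaschke_sequence_def)
  qed
  then show ?thesis
    by (intro abs_convergent_prod_imp_convergent_prod) (simp add: abs_convergent_prod_conv_summable)
qed

lemma blaschke_product_LIMSEQ:
  assumes "blaschke_sequence a" "cmod z < 1"
  shows "(\<lambda>k. \<Prod>n<k. blaschke_factor (a n) z) \<longlonglongrightarrow> blaschke_product a z"
  using has_prod_imp_tendsto'[OF convergent_prod_has_prod[OF blaschke_product_convergent[OF assms]]]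
  by (simp add: blaschke_product_def)

lemma blaschke_product_split:
  assumes "blaschke_sequence a" "cmod z < 1"
  shows "blaschke_product a z =
    (\<Prod>n<k. blaschke_factor (a n) z) * blaschke_product (\<lambda>n. a (n + k)) z"
  using has_prod_unique[OF has_prod_ignore_initial_segment'[OF blaschke_product_convergent[OF assms], of k]]
  by (simp add: blaschke_product_def)

lemma cmod_prod_blaschke_factor_le_1:
  assumes "\<And>n::nat. cmod (a n) < 1" "cmod z < 1"
  shows "cmod (\<Prod>n<k. blaschke_factor (a n) z) \<le> 1"
  unfolding prod_norm[symmetric]
  by (intro prod_le_1) (auto intro: cmod_blaschke_factor_le_1 assms)

lemma cmod_blaschke_product_le_1:
  assumes "blaschke_sequence a" "cmod z < 1"
  shows "cmod (blaschke_product a z) \<le> 1"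
  using assms(1)
  by (intro LIMSEQ_le_const2[OF tendsto_norm[OF blaschke_product_LIMSEQ[OF assms]]])
    (auto simp: blaschke_sequence_def intro!: cmod_prod_blaschke_factor_le_1 assms(2))

text \<open>The omitted tail has modulus at most 1. Lower bounds for 1 - |B|^2 may therefore use
  finitely many zeros.\<close>

lemma cmod_blaschke_product_le_partial:
  assumes "blaschke_sequence a" "cmod z < 1"
  shows "cmod (blaschke_product a z) \<le> cmod (\<Prod>n<k. blaschke_factor (a n) z)"
  unfolding blaschke_product_split[OF assms, of k] norm_mult
  using cmod_blaschke_product_le_1[OF blaschke_sequence_shift[OF assms(1), of k] assms(2)]
  by (intro mult_left_le) auto

text \<open>Meant for tails of the sequence: there the sum in the exponent tends to 0, and the bound
  with it.\<close>

lemma cmod_blaschke_product_minus_1_le: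
  assumes a: "blaschke_sequence a" and z: "cmod z \<le> r" "r < 1"
  shows "cmod (blaschke_product a z - 1) \<le> exp (2 / (1 - r) * (\<Sum>n. 1 - cmod (a n))) - 1"
proof (rule LIMSEQ_le_const2)
  show "(\<lambda>k. cmod ((\<Prod>n<k. blaschke_factor (a n) z) - 1)) \<longlonglongrightarrow> cmod (blaschke_product a z - 1)"
    using z by (intro tendsto_intros blaschke_product_LIMSEQ a) simp
  have "cmod ((\<Prod>n<k. blaschke_factor (a n) z) - 1) \<le> exp (2 / (1 - r) * (\<Sum>n. 1 - cmod (a n))) - 1" for k
  proof -
    have "cmod ((\<Prod>n<k. blaschke_factor (a n) z) - 1) \<le>
        (\<Prod>n<k. 1 + cmod (blaschke_factor (a n) z - 1)) - 1"
      using norm_prod_minus1_le_prod_minus1[of "\<lambda>n. blaschke_factor (a n) z - 1" "{..<k}"] by simp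
    also have "(\<Prod>n<k. 1 + cmod (blaschke_factor (a n) z - 1)) \<le>
        exp (\<Sum>n<k. cmod (blaschke_factor (a n) z - 1))"
      by (rule prod_le_exp_sum) simp
    also have "(\<Sum>n<k. cmod (blaschke_factor (a n) z - 1)) \<le> (\<Sum>n<k. 2 / (1 - r) * (1 - cmod (a n)))"
      using a z by (intro sum_mono cmod_blaschke_factor_minus_1_le) (auto simp: blaschke_sequence_def)
    also have "\<dots> = 2 / (1 - r) * (\<Sum>n<k. 1 - cmod (a n))"
      by (simp only: sum_distrib_left)
    also have "\<dots> \<le> 2 / (1 - r) * (\<Sum>n. 1 - cmod (a n))"
      using a z by (intro mult_left_mono sum_le_suminf) (auto simp: blaschke_sequence_def less_imp_le)
    finally show ?thesis by simp
  qed
  then show "\<exists>N. \<forall>k\<ge>N. cmod ((\<Prod>n<k. blaschke_factor (a n) z) - 1)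
      \<le> exp (2 / (1 - r) * (\<Sum>n. 1 - cmod (a n))) - 1"
    by blast
qed

lemma uniform_limit_blaschke_tail:
  assumes a: "blaschke_sequence a" and r: "r < 1"
  shows "uniform_limit (cball 0 r) (\<lambda>k. blaschke_product (\<lambda>n. a (n + k))) (\<lambda>_. 1) sequentially"
proof (rule uniform_limitI)
  fix e :: real assume "e > 0"
  have "(\<lambda>k. \<Sum>n. 1 - cmod (a (n + k))) \<longlonglongrightarrow> 0"
    using a by (intro suminf_exist_split2) (simp add: blaschke_sequence_def)
  then have "(\<lambda>k. exp (2 / (1 - r) * (\<Sum>n. 1 - cmod (a (n + k)))) - 1) \<longlonglongrightarrow> exp (2 / (1 - r) * 0) - 1"
    by (intro tendsto_intros)
  then have "\<forall>\<^sub>F k in sequentially. exp (2 / (1 - r) * (\<Sum>n. 1 - cmod (a (n + k)))) - 1 < e"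
    using \<open>e > 0\<close> by (intro order_tendstoD(2)) auto
  then show "\<forall>\<^sub>F k in sequentially. \<forall>z\<in>cball 0 r. dist (blaschke_product (\<lambda>n. a (n + k)) z) 1 < e"
  proof eventually_elim
    case (elim k)
    then show ?case
      using cmod_blaschke_product_minus_1_le[OF blaschke_sequence_shift[OF a, of k] _ r]
      by (force simp: dist_norm)
  qed
qed

text \<open>With partial product P and tail R the error is P (1 - R), and |P| \<le> 1, so
  convergence of the tails to 1 is enough.\<close>

lemma uniform_limit_blaschke_partial:
  assumes a: "blaschke_sequence a" and r: "r < 1"
  shows "uniform_limit (cball 0 r) (\<lambda>k z. \<Prod>n<k. blaschke_factor (a n) z) (blaschke_product a) sequentially"
proof (rule uniform_limitI)
  fix e :: real assume "e > 0"
  from uniform_limitD[OF uniform_limit_blaschke_tail[OF assms] this]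
  show "\<forall>\<^sub>F k in sequentially. \<forall>z\<in>cball 0 r.
      dist (\<Prod>n<k. blaschke_factor (a n) z) (blaschke_product a z) < e"
  proof eventually_elim
    case (elim k)
    show ?case
    proof
      fix z :: complex assume z: "z \<in> cball 0 r"
      then have z1: "cmod z < 1" using r by simp
      let ?P = "\<Prod>n<k. blaschke_factor (a n) z" and ?R = "blaschke_product (\<lambda>n. a (n + k)) z"
      have "dist ?P (blaschke_product a z) = cmod (?P * (1 - ?R))"
        unfolding blaschke_product_split[OF a z1, of k] by (simp add: dist_norm algebra_simps)
      also have "\<dots> \<le> 1 * cmod (1 - ?R)"
        unfolding norm_mult using a z1
        by (intro mult_right_mono cmod_prod_blaschke_factor_le_1) (auto simp: blaschke_sequence_def)
      also have "\<dots> < e"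
        using elim z by (auto simp: dist_norm norm_minus_commute)
      finally show "dist ?P (blaschke_product a z) < e" .
    qed
  qed
qed

lemma holomorphic_blaschke_factor:
  assumes "cmod a < 1"
  shows "blaschke_factor a holomorphic_on unit_disc"
proof -
  obtain u where u: "cmod u = 1" "\<And>z. blaschke_factor a z = u * ((a - z) / (1 - cnj a * z))"
    using blaschke_factor_alt by blast
  show ?thesis
    unfolding u(2) using one_minus_cnj_mult_nonzero[OF assms]
    by (intro holomorphic_intros) (auto simp: less_imp_le)
qed

lemma holomorphic_blaschke_product:
  assumes a: "blaschke_sequence a"
  shows "blaschke_product a holomorphic_on unit_disc"
proof (rule holomorphic_uniform_sequence)
  show "(\<lambda>z. \<Prod>n<k. blaschke_factor (a n) z) holomorphic_on unit_disc" for k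
    using a by (intro holomorphic_on_prod holomorphic_blaschke_factor) (simp add: blaschke_sequence_def)
next
  fix z :: complex assume z: "z \<in> unit_disc"
  \<comment> \<open>Any radius strictly between |z| and 1 works: the closed disc of radius
    \<open>r - cmod z\<close> about \<open>z\<close> lies in \<open>cball 0 r\<close>, where
    convergence is uniform.\<close>
  define r where "r = (1 + cmod z) / 2"
  have r: "cmod z < r" "r < 1" using z by (auto simp: r_def)
  have sub: "cball z (r - cmod z) \<subseteq> cball 0 r"
    by (auto simp: subset_iff dist_norm) (smt (verit) norm_triangle_ineq3)
  moreover have "cball 0 r \<subseteq> unit_disc" using r by auto
  ultimately have "cball z (r - cmod z) \<subseteq> unit_disc" by blast
  then show "\<exists>d. 0 < d \<and> cball z d \<subseteq> unit_disc \<and>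
      uniform_limit (cball z d) (\<lambda>k z. \<Prod>n<k. blaschke_factor (a n) z) (blaschke_product a) sequentially"
    using r uniform_limit_on_subset[OF uniform_limit_blaschke_partial[OF a r(2)] sub]
    by (intro exI[of _ "r - cmod z"]) auto
qed simp

lemma taylor_coeff_tendsto:
  assumes f: "\<And>k. f k holomorphic_on unit_disc" "g holomorphic_on unit_disc"
    and lim: "uniform_limit (cball 0 (1/2)) f g sequentially"
  shows "(\<lambda>k. taylor_coeff (f k) n) \<longlonglongrightarrow> taylor_coeff g n"
proof (rule tendstoI)
  fix e :: real assume "e > 0"
  \<comment> \<open>Cauchy's estimate on the circle of radius 1/2 costs \<open>2 ^ n\<close>; the
    additional factor 2 leaves \<open>e / 2\<close> and makes the final inequality strict.\<close>
  then have "e / 2 ^ (n + 1) > 0" by simp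
  from uniform_limitD[OF lim this]
  show "\<forall>\<^sub>F k in sequentially. dist (taylor_coeff (f k) n) (taylor_coeff g n) < e"
  proof eventually_elim
    case (elim k)
    have "cmod (taylor_coeff (\<lambda>z. f k z - g z) n) \<le> e / 2 ^ (n + 1) * 2 ^ n"
      using elim by (intro norm_taylor_coeff_le holomorphic_intros f) (auto simp: dist_norm less_imp_le)
    then show ?case
      using \<open>e > 0\<close> by (simp add: taylor_coeff_diff[OF f] dist_norm)
  qed
qed

lemma uniform_limit_mult_right:
  assumes lim: "uniform_limit (cball 0 (1/2)) f l sequentially"
    and "l holomorphic_on unit_disc" "g holomorphic_on unit_disc"
  shows "uniform_limit (cball 0 (1/2)) (\<lambda>k z. f k z * g z) (\<lambda>z. l z * g z) sequentially"
proof -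
  have "bounded (h ` cball 0 (1/2))" if "h holomorphic_on unit_disc" for h :: "complex \<Rightarrow> complex"
  proof -
    have "cball 0 (1/2) \<subseteq> (unit_disc)" by auto
    then show ?thesis
      using that by (intro compact_imp_bounded compact_continuous_image holomorphic_on_imp_continuous_on)
        (auto intro: holomorphic_on_subset)
  qed
  then show ?thesis
    using assms by (intro uniform_lim_mult uniform_limit_const)
qed

text \<open>The partial products preserve the norm of \<open>g\<close>, and semicontinuity passes
  this on as an upper bound.\<close>

lemma H2_blaschke_contraction:
  assumes a: "blaschke_sequence a" and g: "g \<in> H2"
  shows "(\<lambda>z. blaschke_product a z * g z) \<in> H2"
    "H2_norm (\<lambda>z. blaschke_product a z * g z) \<le> H2_norm g"
proof -
  let ?P = "\<lambda>k z. (\<Prod>n<k. blaschke_factor (a n) z) * g z"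
  have P: "?P k \<in> H2" "H2_norm (?P k) = H2_norm g" for k
    using H2_finite_blaschke_mult[OF g, of a k] a by (auto simp: blaschke_sequence_def)
  have hol: "(\<lambda>z. blaschke_product a z * g z) holomorphic_on unit_disc"
    by (intro holomorphic_intros holomorphic_blaschke_product a H2D(1) g)
  have "uniform_limit (cball 0 (1/2)) ?P (\<lambda>z. blaschke_product a z * g z) sequentially"
    by (intro uniform_limit_mult_right uniform_limit_blaschke_partial holomorphic_blaschke_product a H2D(1) g)
      simp
  from H2_Fatou[OF hol P(1) taylor_coeff_tendsto[OF H2D(1)[OF P(1)] hol this], of "H2_norm g"] P(2)
  show "(\<lambda>z. blaschke_product a z * g z) \<in> H2"
    "H2_norm (\<lambda>z. blaschke_product a z * g z) \<le> H2_norm g" by auto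
qed

text \<open>Dropping finitely many factors does not change the norm of \<open>B g\<close>, and the remaining tails
  tend to \<open>1\<close>; so lower semicontinuity of the norm gives the missing inequality.\<close>

lemma H2_norm_blaschke_mult:
  assumes a: "blaschke_sequence a" and g: "g \<in> H2"
  shows "H2_norm (\<lambda>z. blaschke_product a z * g z) = H2_norm g"
proof (rule antisym)
  let ?R = "\<lambda>k z. blaschke_product (\<lambda>n. a (n + k)) z * g z"
  have R: "?R k \<in> H2" for k
    by (intro H2_blaschke_contraction blaschke_sequence_shift a g)
  have norm: "H2_norm (\<lambda>z. blaschke_product a z * g z) = H2_norm (?R k)" for k
  proof -
    have P: "(\<lambda>z. (\<Prod>n<k. blaschke_factor (a n) z) * ?R k z) \<in> H2"
      "H2_norm (\<lambda>z. (\<Prod>n<k. blaschke_factor (a n) z) * ?R k z) = H2_norm (?R k)"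
      using H2_finite_blaschke_mult[OF R, of a k k] a by (auto simp: blaschke_sequence_def)
    show ?thesis
      unfolding P(2)[symmetric]
      by (rule H2_cong(2)[OF P(1)]) (simp add: blaschke_product_split[OF a, of _ k])
  qed
  have "uniform_limit (cball 0 (1/2)) ?R (\<lambda>z. 1 * g z) sequentially"
    by (intro uniform_limit_mult_right uniform_limit_blaschke_tail a H2D(1) g holomorphic_intros) simp
  then have "uniform_limit (cball 0 (1/2)) ?R g sequentially" by simp
  from H2_Fatou(2)[OF H2D(1)[OF g] R taylor_coeff_tendsto[OF H2D(1)[OF R] H2D(1)[OF g] this]]
  show "H2_norm g \<le> H2_norm (\<lambda>z. blaschke_product a z * g z)"
    using norm by (metis order.refl)
qed (rule H2_blaschke_contraction[OF assms])

section \<open>Reproducing kernels\<close>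

definition szego_kernel :: "complex \<Rightarrow> complex \<Rightarrow> complex" where
  "szego_kernel w z = 1 / (1 - cnj w * z)"

lemma taylor_coeff_one: "taylor_coeff (\<lambda>_. 1) n = (if n = 0 then 1 else 0)"
  by (simp add: taylor_coeff_fps[OF has_fps_expansion_1])

lemma H2_one: "(\<lambda>_. 1) \<in> H2"
proof -
  have "summable (\<lambda>n. (cmod (taylor_coeff (\<lambda>_. 1) n))\<^sup>2)"
    by (rule summable_finite[of "{0}"]) (auto simp: taylor_coeff_one)
  then show ?thesis by (simp add: H2_def)
qed

lemma H2_szego_kernel:
  assumes "cmod w < 1"
  shows "szego_kernel w \<in> H2"
  unfolding szego_kernel_def[abs_def] by (rule H2_divide_linear[OF H2_one assms])

lemma taylor_coeff_szego_kernel: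
  assumes w: "cmod w < 1"
  shows "taylor_coeff (szego_kernel w) n = cnj w ^ n"
proof -
  have rec: "(if n = 0 then 1 else 0) = taylor_coeff (szego_kernel w) n -
      cnj w * (if n = 0 then 0 else taylor_coeff (szego_kernel w) (n - 1))" for n
  proof -
    have "taylor_coeff (\<lambda>_. 1) n = taylor_coeff (\<lambda>z. (1 - cnj w * z) * szego_kernel w z) n"
      using one_minus_cnj_mult_nonzero[OF w] by (intro taylor_coeff_cong) (auto simp: szego_kernel_def)
    then show ?thesis
      using taylor_coeff_linear_mult[OF H2D(1)[OF H2_szego_kernel[OF w]], of 1 "cnj w" n]
      by (simp add: taylor_coeff_one)
  qed
  show ?thesis
  proof (induction n)
    case 0 show ?case using rec[of 0] by simp
  next
    case (Suc n) then show ?case using rec[of "Suc n"] by simp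
  qed
qed

lemma szego_kernel_reproducing:
  assumes "f holomorphic_on unit_disc" "cmod w < 1"
  shows "(\<lambda>n. taylor_coeff f n * cnj (taylor_coeff (szego_kernel w) n)) sums f w"
  using taylor_coeff_sums[OF assms(1), of w] assms(2) by (simp add: taylor_coeff_szego_kernel)

lemma H2_inner_sums:
  assumes "f \<in> H2" "g \<in> H2"
  shows "(\<lambda>n. taylor_coeff f n * cnj (taylor_coeff g n)) sums H2_inner f g"
proof -
  have "summable (\<lambda>n. taylor_coeff f n * cnj (taylor_coeff g n))"
  proof (rule summable_comparison_test')
    show "summable (\<lambda>n. (cmod (taylor_coeff f n))\<^sup>2 + (cmod (taylor_coeff g n))\<^sup>2)"
      using assms by (intro summable_add H2D(2))
    show "norm (taylor_coeff f n * cnj (taylor_coeff g n)) \<le>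
        (cmod (taylor_coeff f n))\<^sup>2 + (cmod (taylor_coeff g n))\<^sup>2" for n
      using sum_squares_bound[of "cmod (taylor_coeff f n)" "cmod (taylor_coeff g n)"]
        mult_nonneg_nonneg[OF norm_ge_zero[of "taylor_coeff f n"] norm_ge_zero[of "taylor_coeff g n"]]
      unfolding real_norm_def norm_mult complex_mod_cnj by linarith
  qed
  then show ?thesis by (simp add: H2_inner_def summable_sums)
qed

lemma H2_Cauchy_Schwarz:
  assumes "f \<in> H2" "g \<in> H2"
  shows "cmod (H2_inner f g) \<le> H2_norm f * H2_norm g"
proof (rule LIMSEQ_le_const2)
  let ?s = "\<lambda>m. \<Sum>n<m. taylor_coeff f n * cnj (taylor_coeff g n)"
  show "(\<lambda>m. cmod (?s m)) \<longlonglongrightarrow> cmod (H2_inner f g)"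
    using H2_inner_sums[OF assms] unfolding sums_def by (rule tendsto_norm)
  have L2: "L2_set (\<lambda>n. cmod (taylor_coeff h n)) {..<m} \<le> H2_norm h" if "h \<in> H2" for h m
    using that by (auto simp: L2_set_def intro!: real_le_lsqrt H2_norm_nonneg H2_norm_partial_sum_le sum_nonneg)
  have "cmod (?s m) \<le> H2_norm f * H2_norm g" for m
  proof -
    have "cmod (?s m) \<le> (\<Sum>n<m. \<bar>cmod (taylor_coeff f n)\<bar> * \<bar>cmod (taylor_coeff g n)\<bar>)"
      by (rule order.trans[OF norm_sum]) (simp add: norm_mult)
    also have "\<dots> \<le> L2_set (\<lambda>n. cmod (taylor_coeff f n)) {..<m} * L2_set (\<lambda>n. cmod (taylor_coeff g n)) {..<m}"
      by (rule L2_set_mult_ineq)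
    also have "\<dots> \<le> H2_norm f * H2_norm g"
      using assms by (intro mult_mono L2 H2_norm_nonneg) auto
    finally show ?thesis .
  qed
  then show "\<exists>N. \<forall>m\<ge>N. cmod (?s m) \<le> H2_norm f * H2_norm g" by blast
qed

lemma model_kernel_alt:
  "model_kernel B w = (\<lambda>z. szego_kernel w z - cnj (B w) * (B z * szego_kernel w z))"
  by (auto simp: model_kernel_def szego_kernel_def diff_divide_distrib)

lemma taylor_coeff_model_kernel:
  assumes a: "blaschke_sequence a" and w: "cmod w < 1"
  defines "B \<equiv> blaschke_product a"
  shows "taylor_coeff (model_kernel B w) n = taylor_coeff (szego_kernel w) n
    - cnj (B w) * taylor_coeff (\<lambda>z. B z * szego_kernel w z) n"
  unfolding model_kernel_alt B_def
  using H2D(1)[OF H2_szego_kernel[OF w]] holomorphic_blaschke_product[OF a]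
  by (simp add: taylor_coeff_diff taylor_coeff_cmult holomorphic_on_mult)

text \<open>Expanding the squared coefficients of the difference leaves three sums. By the isometry
  both pure squares sum to the squared norm \<open>s\<close> of the Szego kernel, and the mixed sum
  is evaluated by reproducing \<open>B z * szego_kernel w z\<close> at \<open>w\<close>.\<close>

lemma
  assumes a: "blaschke_sequence a" and w: "cmod w < 1"
  defines "B \<equiv> blaschke_product a"
  shows H2_model_kernel: "model_kernel B w \<in> H2"
    and H2_norm_model_kernel: "H2_norm (model_kernel B w) = sqrt ((1 - (cmod (B w))\<^sup>2) / (1 - (cmod w)\<^sup>2))"
proof -
  have H2: "szego_kernel w \<in> H2" "(\<lambda>z. B z * szego_kernel w z) \<in> H2"
    using H2_szego_kernel[OF w] H2_blaschke_contraction(1)[OF a] by (auto simp: B_def)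
  define c where "c = taylor_coeff (szego_kernel w)"
  define d where "d = taylor_coeff (\<lambda>z. B z * szego_kernel w z)"
  define s where "s = 1 / (1 - (cmod w)\<^sup>2)"
  have w2: "(cmod w)\<^sup>2 < 1" using w by (simp add: abs_square_less_1)
  have c: "(\<lambda>n. (cmod (c n))\<^sup>2) sums s"
    using geometric_sums[of "(cmod w)\<^sup>2"] w2
    by (simp add: c_def s_def taylor_coeff_szego_kernel[OF w] norm_power power_mult[symmetric] mult.commute)
  have "H2_norm (szego_kernel w) = sqrt s"
    using sums_unique[OF c] by (simp add: H2_norm_def c_def)
  then have "H2_norm (\<lambda>z. B z * szego_kernel w z) = sqrt s"
    unfolding B_def by (simp add: H2_norm_blaschke_mult[OF a H2(1)])
  moreover have "0 \<le> s" using w2 by (simp add: s_def)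
  ultimately have d: "(\<lambda>n. (cmod (d n))\<^sup>2) sums s"
    using H2_norm_square[OF H2(2)] by (simp add: d_def)
  have "(\<lambda>n. d n * cnj (c n)) sums (B w * szego_kernel w w)"
    unfolding c_def d_def by (rule szego_kernel_reproducing[OF H2D(1)[OF H2(2)] w])
  moreover have "szego_kernel w w = of_real s"
    unfolding szego_kernel_def s_def
    by (simp add: complex_norm_square mult.commute flip: of_real_power)
  ultimately have "(\<lambda>n. Re (cnj (B w) * (d n * cnj (c n)))) sums Re (cnj (B w) * (B w * of_real s))"
    by (intro sums_Re sums_mult) simp
  also have "Re (cnj (B w) * (B w * of_real s)) = (cmod (B w))\<^sup>2 * s"
    unfolding cmod_power2 by (simp add: power2_eq_square algebra_simps)
  finally have cd: "(\<lambda>n. Re (cnj (B w) * (d n * cnj (c n)))) sums ((cmod (B w))\<^sup>2 * s)" .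
  have expand: "(cmod (taylor_coeff (model_kernel B w) n))\<^sup>2 =
      (cmod (c n))\<^sup>2 + (cmod (B w))\<^sup>2 * (cmod (d n))\<^sup>2 - 2 * Re (cnj (B w) * (d n * cnj (c n)))" for n
    unfolding B_def taylor_coeff_model_kernel[OF a w] c_def[symmetric] d_def[unfolded B_def, symmetric] cmod_power2
    by (simp add: power2_eq_square algebra_simps)
  have "(\<lambda>n. (cmod (taylor_coeff (model_kernel B w) n))\<^sup>2) sums
      (s + (cmod (B w))\<^sup>2 * s - 2 * ((cmod (B w))\<^sup>2 * s))"
    unfolding expand by (intro sums_add sums_diff sums_mult c d cd)
  also have "s + (cmod (B w))\<^sup>2 * s - 2 * ((cmod (B w))\<^sup>2 * s) = (1 - (cmod (B w))\<^sup>2) / (1 - (cmod w)\<^sup>2)"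
    by (simp add: s_def diff_divide_distrib)
  finally have k: "(\<lambda>n. (cmod (taylor_coeff (model_kernel B w) n))\<^sup>2) sums
      ((1 - (cmod (B w))\<^sup>2) / (1 - (cmod w)\<^sup>2))" .
  show "H2_norm (model_kernel B w) = sqrt ((1 - (cmod (B w))\<^sup>2) / (1 - (cmod w)\<^sup>2))"
    using sums_unique[OF k] by (simp add: H2_norm_def)
  have "model_kernel B w holomorphic_on unit_disc"
    unfolding model_kernel_alt by (intro holomorphic_intros H2D(1) H2)
  with k show "model_kernel B w \<in> H2"
    by (simp add: H2_def sums_iff)
qed

text \<open>The model kernel differs from the Szego kernel by an element of \<open>B H^2\<close>,
  which pairs to zero with \<open>f\<close>. So it also reproduces \<open>f w\<close>, and
  Cauchy-Schwarz applies.\<close>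

lemma cmod_le_model_kernel_norm:
  assumes a: "blaschke_sequence a" and w: "cmod w < 1"
    and f: "f \<in> model_space (blaschke_product a)"
  shows "cmod (f w) \<le> H2_norm f * H2_norm (model_kernel (blaschke_product a) w)"
proof -
  let ?B = "blaschke_product a"
  have fH: "f \<in> H2" and orth: "H2_inner f (\<lambda>z. ?B z * szego_kernel w z) = 0"
    using f H2_szego_kernel[OF w] by (auto simp: model_space_def)
  have "(\<lambda>n. taylor_coeff f n * cnj (taylor_coeff (\<lambda>z. ?B z * szego_kernel w z) n)) sums 0"
    using H2_inner_sums[OF fH H2_blaschke_contraction(1)[OF a H2_szego_kernel[OF w]]] by (simp add: orth)
  from sums_diff[OF szego_kernel_reproducing[OF H2D(1)[OF fH] w] sums_mult[OF this, of "?B w"]]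
  have "(\<lambda>n. taylor_coeff f n * cnj (taylor_coeff (model_kernel ?B w) n)) sums f w"
    by (simp add: taylor_coeff_model_kernel[OF a w] algebra_simps)
  then have "H2_inner f (model_kernel ?B w) = f w"
    by (simp add: H2_inner_def sums_iff)
  then show ?thesis
    using H2_Cauchy_Schwarz[OF fH H2_model_kernel[OF a w]] by simp
qed

section \<open>Two-sided bounds for the kernel norm\<close>

text \<open>The Weierstrass product inequality.\<close>

lemma one_minus_sum_le_prod:
  fixes v :: "nat \<Rightarrow> real"
  assumes "\<And>n. 0 \<le> v n" "\<And>n. v n \<le> 1"
  shows "1 - (\<Sum>n<k. v n) \<le> (\<Prod>n<k. 1 - v n)"
proof (induction k)
  case (Suc k)
  have "(\<Prod>n<k. 1 - v n) \<le> 1"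
    by (intro prod_le_1) (use assms in auto)
  then have "(\<Prod>n<k. 1 - v n) * v k \<le> 1 * v k"
    by (intro mult_right_mono assms)
  then show ?case using Suc by (simp add: algebra_simps)
qed simp

lemma prod_one_minus_le_exp:
  fixes v :: "nat \<Rightarrow> real"
  assumes "\<And>n. v n \<le> 1"
  shows "(\<Prod>n<k. 1 - v n) \<le> exp (- (\<Sum>n<k. v n))"
proof -
  have "(\<Prod>n<k. 1 - v n) \<le> (\<Prod>n<k. exp (- v n))"
    using assms exp_ge_add_one_self[of "- v n" for n] by (intro prod_mono) auto
  also have "\<dots> = exp (\<Sum>n<k. - v n)"
    by (rule exp_sum[symmetric]) simp
  finally show ?thesis by (simp add: sum_negf)
qed

text \<open>The left side grows linearly while the right side saturates at 1, so a bound
  \<open>K\<close> on \<open>s\<close> has to enter the constant. The rest is exp s - 1 \<ge>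
  s.\<close>

lemma one_minus_exp_neg_ge:
  fixes s :: real
  assumes "0 \<le> s" "s \<le> K"
  shows "exp (- K) * s \<le> 1 - exp (- s)"
proof -
  have "exp (- K) * s \<le> exp (- s) * s"
    using assms by (intro mult_right_mono) auto
  also have "\<dots> \<le> exp (- s) * (exp s - 1)"
    using exp_ge_add_one_self[of s] by (intro mult_left_mono) (auto simp del: exp_ge_add_one_self)
  also have "\<dots> = 1 - exp (- s)"
    by (simp add: algebra_simps flip: exp_add)
  finally show ?thesis .
qed

text \<open>One summand v_n without its factor 1 - |z|^2, which cancels against the denominator of
  the squared kernel norm.\<close>

definition kernel_term :: "complex \<Rightarrow> complex \<Rightarrow> real" where
  "kernel_term a z = (1 - (cmod a)\<^sup>2) / (cmod (1 - cnj a * z))\<^sup>2"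

lemma kernel_term_nonneg: "cmod a < 1 \<Longrightarrow> 0 \<le> kernel_term a z"
  by (simp add: kernel_term_def abs_square_le_1)

lemma cmod_blaschke_factor_power2:
  assumes "cmod a < 1" "cmod z < 1"
  shows "(cmod (blaschke_factor a z))\<^sup>2 = 1 - (1 - (cmod z)\<^sup>2) * kernel_term a z"
  using one_minus_blaschke_factor_power2[OF assms] by (simp add: kernel_term_def algebra_simps)

text \<open>The two halves are asymmetric. The upper bound passes to the infinite product and
  therefore asks for all partial sums, of whatever size. The lower bound truncates at one
  \<open>k\<close>, and the exponential estimate requires the weighted sum to stay below
  \<open>K\<close>.\<close>

lemma kernel_norm_square_bounds:
  assumes a: "blaschke_sequence a" and z: "cmod z < 1"
  defines "\<kappa> \<equiv> (1 - (cmod (blaschke_product a z))\<^sup>2) / (1 - (cmod z)\<^sup>2)"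
  shows kernel_norm_square_le: "(\<And>k. (\<Sum>n<k. kernel_term (a n) z) \<le> Q) \<Longrightarrow> \<kappa> \<le> Q"
    and kernel_norm_square_ge: "(1 - (cmod z)\<^sup>2) * (\<Sum>n<k. kernel_term (a n) z) \<le> K \<Longrightarrow>
      exp (- K) * (\<Sum>n<k. kernel_term (a n) z) \<le> \<kappa>"
proof -
  have an: "cmod (a n) < 1" for n
    using a by (simp add: blaschke_sequence_def)
  define d where "d = 1 - (cmod z)\<^sup>2"
  have d: "d > 0" using z by (simp add: d_def abs_square_less_1)
  define v where "v n = d * kernel_term (a n) z" for n
  have v: "(cmod (blaschke_factor (a n) z))\<^sup>2 = 1 - v n" for n
    unfolding v_def d_def by (rule cmod_blaschke_factor_power2[OF an z])
  have v0: "0 \<le> v n" for n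
    using d kernel_term_nonneg[OF an] by (simp add: v_def)
  have v1: "v n \<le> 1" for n
    using v[of n] zero_le_power2[of "cmod (blaschke_factor (a n) z)"] by linarith
  have vsum: "(\<Sum>n<k. v n) = d * (\<Sum>n<k. kernel_term (a n) z)" for k
    by (simp add: v_def sum_distrib_left)
  have P: "(cmod (\<Prod>n<k. blaschke_factor (a n) z))\<^sup>2 = (\<Prod>n<k. 1 - v n)" for k
    unfolding prod_norm[symmetric] by (simp add: prod_power_distrib v)
  show "\<kappa> \<le> Q" if Q: "\<And>k. (\<Sum>n<k. kernel_term (a n) z) \<le> Q"
  proof -
    have "1 - (cmod (blaschke_product a z))\<^sup>2 \<le> d * Q"
    proof (rule LIMSEQ_le_const2)
      show "(\<lambda>k. 1 - (cmod (\<Prod>n<k. blaschke_factor (a n) z))\<^sup>2) \<longlonglongrightarrow> 1 - (cmod (blaschke_product a z))\<^sup>2"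
        by (intro tendsto_intros blaschke_product_LIMSEQ a z)
      have "1 - (cmod (\<Prod>n<k. blaschke_factor (a n) z))\<^sup>2 \<le> d * Q" for k
        using one_minus_sum_le_prod[of v k, OF v0 v1] mult_left_mono[OF Q[of k], of d] d
        unfolding P vsum by linarith
      then show "\<exists>N. \<forall>k\<ge>N. 1 - (cmod (\<Prod>n<k. blaschke_factor (a n) z))\<^sup>2 \<le> d * Q" by blast
    qed
    then show ?thesis
      using d by (simp add: \<kappa>_def d_def[symmetric] divide_le_eq mult.commute)
  qed
  show "exp (- K) * (\<Sum>n<k. kernel_term (a n) z) \<le> \<kappa>"
    if K: "(1 - (cmod z)\<^sup>2) * (\<Sum>n<k. kernel_term (a n) z) \<le> K"
  proof -
    have "exp (- K) * (\<Sum>n<k. v n) \<le> 1 - exp (- (\<Sum>n<k. v n))"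
      using K by (intro one_minus_exp_neg_ge sum_nonneg v0) (simp add: vsum d_def)
    also have "\<dots> \<le> 1 - (\<Prod>n<k. 1 - v n)"
      using prod_one_minus_le_exp[of v k, OF v1] by simp
    also have "\<dots> \<le> 1 - (cmod (blaschke_product a z))\<^sup>2"
      using cmod_blaschke_product_le_partial[OF a z, of k] by (auto simp flip: P intro!: power_mono)
    finally show ?thesis
      using d by (simp add: \<kappa>_def d_def[symmetric] le_divide_eq vsum algebra_simps)
  qed
qed

section \<open>The tangential zeros\<close>

locale tangential_zeros =
  fixes x :: "nat \<Rightarrow> real"
  assumes x_pos: "n \<ge> 1 \<Longrightarrow> x n > 0"
    and x_decreasing: "n \<ge> 1 \<Longrightarrow> x (Suc n) \<le> x n"
    and cmod_zero_less: "n \<ge> 1 \<Longrightarrow> cmod (tangential_zero x n) < 1"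
begin

abbreviation "\<zeta> \<equiv> tangential_zero x"

text \<open>\<open>1 - gap n\<close> is the signed real factor of the zero, not its modulus:
  \<open>gap 1\<close> may exceed 1.\<close>

definition gap :: "nat \<Rightarrow> real" where
  "gap n = x n / 4 ^ n"

lemma x_le_first: "n \<ge> 1 \<Longrightarrow> x n \<le> x 1"
  by (induction n rule: dec_induct) (use x_decreasing in \<open>auto intro: order.trans\<close>)

lemma zero_eq: "\<zeta> n = of_real (1 - gap n) * exp (\<i> * of_real (1 / 2 ^ n))"
  by (simp add: tangential_zero_def gap_def power_mult)

lemma cmod_zero: "cmod (\<zeta> n) = \<bar>1 - gap n\<bar>"
  unfolding zero_eq norm_mult norm_exp_i_times norm_of_real by simp

lemma gap_bounds:
  assumes "n \<ge> 1"
  shows "0 < gap n" "gap n < 2"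
  using x_pos[OF assms] cmod_zero_less[OF assms] by (auto simp: cmod_zero gap_def)

lemma gap_le_first:
  assumes "n \<ge> 1"
  shows "gap n \<le> gap 1"
proof -
  have "(4::real) ^ 1 \<le> 4 ^ n" using assms by (intro power_increasing) auto
  then show ?thesis
    unfolding gap_def using x_le_first[OF assms] x_pos[of 1] by (intro frac_le) auto
qed

text \<open>The disc condition at the first zero gives \<open>x 1 < 8\<close>; monotonicity passes
  this on, and \<open>4 ^ n\<close> is at least 16. So only the first real factor can be small or
  negative.\<close>

lemma gap_less_half:
  assumes "n \<ge> 2"
  shows "gap n < 1 / 2"
proof -
  have "x 1 < 8" using gap_bounds(2)[of 1] by (simp add: gap_def)
  then have "x n < 8" using x_le_first[of n] assms by simp
  moreover have "(4::real) ^ 2 \<le> 4 ^ n" using assms by (intro power_increasing) auto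
  ultimately show ?thesis by (simp add: gap_def divide_less_eq)
qed

lemma one_minus_zero_square_le:
  "1 - (cmod (\<zeta> n))\<^sup>2 \<le> 2 * gap n"
  by (simp add: cmod_zero power2_eq_square algebra_simps)

text \<open>Since 1 - (1 - g)^2 = (2 - g) g, a uniform constant needs the largest gap, which is the
  first one and lies below 2.\<close>

lemma one_minus_zero_square_ge:
  assumes "n \<ge> 1"
  shows "(2 - gap 1) * gap n \<le> 1 - (cmod (\<zeta> n))\<^sup>2"
proof -
  have "(2 - gap 1) * gap n \<le> (2 - gap n) * gap n"
    using gap_le_first[OF assms] gap_bounds[OF assms] by (intro mult_right_mono) auto
  then show ?thesis by (simp add: cmod_zero power2_eq_square algebra_simps)
qed

lemma blaschke_sequence_zeros: "blaschke_sequence (\<lambda>n. \<zeta> (Suc n))"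
proof -
  have "summable (\<lambda>n. 1 - cmod (\<zeta> (Suc n)))"
  proof (rule summable_comparison_test')
    show "summable (\<lambda>n. x 1 * (1 / 4) ^ n)"
      by (intro summable_mult summable_geometric) simp
    show "norm (1 - cmod (\<zeta> (Suc n))) \<le> x 1 * (1 / 4) ^ n" for n
    proof -
      have "norm (1 - cmod (\<zeta> (Suc n))) \<le> gap (Suc n)"
        using gap_bounds[of "Suc n"] cmod_zero_less[of "Suc n"] by (auto simp: cmod_zero)
      also have "\<dots> \<le> x 1 / 4 ^ n"
        unfolding gap_def using x_le_first[of "Suc n"] x_pos[of "1"] by (intro frac_le) auto
      finally show ?thesis by (simp add: power_one_over)
    qed
  qed
  then show ?thesis
    using cmod_zero_less by (simp add: blaschke_sequence_def)
qed

lemma cmod_one_minus_zero_le: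
  assumes "n \<ge> 1"
  shows "cmod (1 - \<zeta> n) \<le> (1 + x 1) / 2 ^ n"
proof -
  let ?e = "exp (\<i> * of_real (1 / 2 ^ n))"
  have "cmod (1 - ?e) = 2 * \<bar>sin (1 / 2 ^ n / 2)\<bar>"
    using dist_exp_i_1[of "1 / 2 ^ n"] by (simp only: dist_norm norm_minus_commute)
  also have "\<dots> \<le> 1 / 2 ^ n"
    using abs_sin_x_le_abs_x[of "1 / 2 ^ n / 2"] by simp
  finally have e: "cmod (1 - ?e) \<le> 1 / 2 ^ n" .
  have "(2::real) ^ n \<le> 4 ^ n" by (intro power_mono) auto
  then have g: "gap n \<le> x 1 / 2 ^ n"
    unfolding gap_def using x_le_first[OF assms] x_pos[of 1] by (intro frac_le) auto
  have "1 - \<zeta> n = (1 - ?e) + of_real (gap n) * ?e"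
    by (simp add: zero_eq algebra_simps)
  then have "cmod (1 - \<zeta> n) \<le> cmod (1 - ?e) + cmod (of_real (gap n) * ?e)"
    by (metis norm_triangle_ineq)
  also have "cmod (of_real (gap n) * ?e) = gap n"
    unfolding norm_mult norm_exp_i_times norm_of_real using gap_bounds(1)[OF assms] by simp
  finally show ?thesis using e g by (simp add: add_divide_distrib)
qed

text \<open>From the second zero on, the imaginary part \<open>(1 - gap n) * sin (1 / 2 ^ n)\<close>
  already has order \<open>1 / 2 ^ n\<close>. For the first zero it may vanish, so the distance to
  the circle serves instead.\<close>

lemma cmod_one_minus_zero_ge:
  obtains c where "c > 0" "\<And>n. n \<ge> 1 \<Longrightarrow> c / 2 ^ n \<le> cmod (1 - \<zeta> n)"
proof
  \<comment> \<open>1/4 is the product of 1 - gap n \<ge> 1/2 and sin t \<ge> t/2; the factor 2 in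
    the other entry cancels the \<open>2 ^ 1\<close> of the first zero.\<close>
  define c where "c = min (1 / 4) (2 * (1 - cmod (\<zeta> 1)))"
  show "c > 0" using cmod_zero_less[of 1] by (simp add: c_def)
  show "c / 2 ^ n \<le> cmod (1 - \<zeta> n)" if "n \<ge> 1" for n
  proof (cases "n = 1")
    case True
    have "1 - cmod (\<zeta> 1) \<le> cmod (1 - \<zeta> 1)"
      using norm_triangle_ineq2[of 1 "\<zeta> 1"] by simp
    then show ?thesis using True by (simp add: c_def)
  next
    case False
    then have g: "gap n < 1 / 2" using gap_less_half[of n] that by simp
    define t :: real where "t = 1 / 2 ^ n"
    have t: "0 < t" "t \<le> 1" by (simp_all add: t_def)
    have "\<bar>sin t - t\<bar> \<le> inverse (fact 3) * \<bar>t\<bar> ^ 3"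
      using Maclaurin_sin_bound[of t 3] by (simp add: sin_coeff_def eval_nat_numeral)
    moreover have "\<bar>t\<bar> ^ 3 \<le> t"
      using t mult_le_one[of t t] by (simp add: power3_eq_cube mult_left_le)
    then have "inverse (fact 3) * \<bar>t\<bar> ^ 3 \<le> t / 6"
      by (simp add: fact_numeral)
    ultimately have "t / 2 \<le> sin t"
      using t by linarith
    then have "1 / 2 * (t / 2) \<le> (1 - gap n) * sin t"
      using g t by (intro mult_mono) auto
    also have "\<dots> = Im (\<zeta> n)"
      by (simp add: zero_eq t_def[symmetric] exp_eq_polar flip: cis_conv_exp)
    also have "\<dots> \<le> cmod (1 - \<zeta> n)"
      using abs_Im_le_cmod[of "1 - \<zeta> n"] by simp
    finally have "1 / 4 / 2 ^ n \<le> cmod (1 - \<zeta> n)" by (simp add: t_def)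
    moreover have "c / 2 ^ n \<le> 1 / 4 / 2 ^ n"
      unfolding c_def by (intro divide_right_mono min.cobounded1) simp
    ultimately show ?thesis by linarith
  qed
qed

section \<open>Kernel terms in a Stolz domain\<close>

context
  fixes \<alpha> :: real and z :: complex
  assumes \<alpha>: "\<alpha> > 1" and z: "z \<in> stolz_domain \<alpha> 1"
begin

lemma stolz: "cmod z < 1" "cmod (1 - z) \<le> \<alpha> * (1 - cmod z)"
  using z by (auto simp: stolz_domain_def divide_less_eq norm_minus_commute)

lemma denominator_le:
  assumes "n \<ge> 1"
  shows "cmod (1 - cnj (\<zeta> n) * z) \<le> \<alpha> * (1 - cmod z) + (1 + x 1) / 2 ^ n"
proof -
  have "1 - cnj (\<zeta> n) * z = cnj (\<zeta> n) * (1 - z) + cnj (1 - \<zeta> n)"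
    by (simp add: algebra_simps)
  then have "cmod (1 - cnj (\<zeta> n) * z) \<le> cmod (\<zeta> n) * cmod (1 - z) + cmod (1 - \<zeta> n)"
    by (metis norm_triangle_ineq norm_mult complex_mod_cnj)
  also have "cmod (\<zeta> n) * cmod (1 - z) \<le> 1 * cmod (1 - z)"
    using cmod_zero_less[OF assms] by (intro mult_right_mono) auto
  finally show ?thesis
    using stolz cmod_one_minus_zero_le[OF assms] by simp
qed

text \<open>The second bound feeds on the first: |1 - \<zeta>_n| is at most D + |1 - z| for the
  denominator D, and the Stolz condition gives |1 - z| \<le> \<alpha> (1 - |z|) \<le> \<alpha>
  D.\<close>

lemma denominator_ge:
  assumes "n \<ge> 1"
  shows "1 - cmod z \<le> cmod (1 - cnj (\<zeta> n) * z)"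
    "cmod (1 - \<zeta> n) / (2 * \<alpha>) \<le> cmod (1 - cnj (\<zeta> n) * z)"
proof -
  let ?D = "cmod (1 - cnj (\<zeta> n) * z)"
  have "cmod (\<zeta> n) * cmod z \<le> 1 * cmod z"
    using cmod_zero_less[OF assms] by (intro mult_right_mono) auto
  then show D: "1 - cmod z \<le> ?D"
    using cmod_one_minus_cnj_mult_ge[of "\<zeta> n" z] by simp
  have "cnj (1 - \<zeta> n) = (1 - cnj (\<zeta> n) * z) - cnj (\<zeta> n) * (1 - z)"
    by (simp add: algebra_simps)
  then have "cmod (1 - \<zeta> n) \<le> ?D + cmod (\<zeta> n) * cmod (1 - z)"
    by (metis norm_triangle_ineq4 norm_mult complex_mod_cnj)
  also have "cmod (\<zeta> n) * cmod (1 - z) \<le> 1 * cmod (1 - z)"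
    using cmod_zero_less[OF assms] by (intro mult_right_mono) auto
  also have "1 * cmod (1 - z) \<le> \<alpha> * ?D"
    using order.trans[OF stolz(2) mult_left_mono[OF D, of \<alpha>]] \<alpha> by simp
  also have "?D + \<alpha> * ?D \<le> 2 * \<alpha> * ?D"
    using \<alpha> mult_right_mono[of 1 \<alpha> ?D] by simp
  finally show "cmod (1 - \<zeta> n) / (2 * \<alpha>) \<le> ?D"
    using \<alpha> by (simp add: divide_le_eq mult.commute)
qed

text \<open>For n \<le> M both parts of the upper bound for the denominator are of order
  \<open>1 / 2 ^ n\<close>; squaring cancels the \<open>4 ^ n\<close> in \<open>gap n\<close> and
  leaves \<open>x n\<close>.\<close>

lemma kernel_term_ge:
  assumes n: "n \<ge> 1" "n \<le> M" and M: "1 - cmod z \<le> 2 / 2 ^ M"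
  shows "(2 - gap 1) / (2 * \<alpha> + 1 + x 1)\<^sup>2 * x n \<le> kernel_term (\<zeta> n) z"
proof -
  let ?D = "cmod (1 - cnj (\<zeta> n) * z)" and ?C = "2 * \<alpha> + 1 + x 1"
  have C: "?C > 0" using \<alpha> x_pos[of 1] by simp
  have "(2::real) / 2 ^ M \<le> 2 / 2 ^ n"
    using n by (intro divide_left_mono power_increasing) auto
  then have "\<alpha> * (1 - cmod z) \<le> \<alpha> * (2 / 2 ^ n)"
    using \<alpha> M by (intro mult_left_mono) auto
  then have D: "?D \<le> ?C / 2 ^ n"
  proof -
    have "?C / 2 ^ n = \<alpha> * (2 / 2 ^ n) + (1 + x 1) / 2 ^ n"
      by (simp add: add_divide_distrib)
    then show ?thesis using denominator_le[OF n(1)] \<open>\<alpha> * (1 - cmod z) \<le> _\<close> by linarith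
  qed
  have D0: "0 < ?D" using denominator_ge(1)[OF n(1)] stolz(1) by linarith
  have "(2 - gap 1) / ?C\<^sup>2 * x n = (2 - gap 1) * gap n / (?C / 2 ^ n)\<^sup>2"
    by (simp add: gap_def power_divide flip: power_mult) (simp add: power_mult mult.commute[of n])
  also have "\<dots> \<le> (1 - (cmod (\<zeta> n))\<^sup>2) / ?D\<^sup>2"
  proof (rule frac_le)
    show "0 \<le> 1 - (cmod (\<zeta> n))\<^sup>2" using cmod_zero_less[OF n(1)] by (simp add: abs_square_le_1)
  qed (use D D0 one_minus_zero_square_ge[OF n(1)] in \<open>auto intro: power_mono\<close>)
  finally show ?thesis by (simp add: kernel_term_def)
qed

lemma kernel_term_le:
  assumes n: "n \<ge> 1" and d: "d > 0" "d \<le> cmod (1 - cnj (\<zeta> n) * z)"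
  shows "kernel_term (\<zeta> n) z \<le> 2 * gap n / d\<^sup>2"
  unfolding kernel_term_def using d gap_bounds(1)[OF n]
  by (intro frac_le one_minus_zero_square_le power_mono) auto

text \<open>Up to \<open>M\<close> the denominator is bounded below by the distance of the zero to
  1, beyond \<open>M\<close> by \<open>1 - cmod z\<close>. The first choice yields multiples of
  \<open>x n\<close>, the second a geometric tail.\<close>

lemma sum_kernel_term_le:
  assumes c: "c > 0" "\<And>n. n \<ge> 1 \<Longrightarrow> c / 2 ^ n \<le> cmod (1 - \<zeta> n)"
    and M: "M \<ge> 1" "1 / 2 ^ (M + 1) \<le> 1 - cmod z"
  shows "(\<Sum>n=1..k. kernel_term (\<zeta> n) z) \<le> (8 * \<alpha>\<^sup>2 / c\<^sup>2 + 8) * (\<Sum>n=1..M. x n)"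
proof -
  let ?K = "8 * \<alpha>\<^sup>2 / c\<^sup>2"
  have near: "kernel_term (\<zeta> n) z \<le> ?K * x n" if n: "n \<ge> 1" for n
  proof -
    have "c / 2 ^ n / (2 * \<alpha>) \<le> cmod (1 - \<zeta> n) / (2 * \<alpha>)"
      using c(2)[OF n] \<alpha> by (intro divide_right_mono) auto
    then have "c / 2 ^ n / (2 * \<alpha>) \<le> cmod (1 - cnj (\<zeta> n) * z)"
      using denominator_ge(2)[OF n] by linarith
    then have "kernel_term (\<zeta> n) z \<le> 2 * gap n / (c / 2 ^ n / (2 * \<alpha>))\<^sup>2"
      using \<alpha> c(1) by (intro kernel_term_le n) auto
    also have "\<dots> = ?K * x n"
      by (simp add: gap_def power_divide power_mult_distrib flip: power_mult)
        (simp add: power_mult mult.commute[of n])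
    finally show ?thesis .
  qed
  have far: "kernel_term (\<zeta> n) z \<le> 8 * x 1 * (4 ^ M / 4 ^ n)" if n: "n \<ge> 1" for n
  proof -
    have "kernel_term (\<zeta> n) z \<le> 2 * gap n / (1 / 2 ^ (M + 1))\<^sup>2"
      using denominator_ge(1)[OF n] M(2) by (intro kernel_term_le n) auto
    also have "\<dots> = 8 * x n * (4 ^ M / 4 ^ n)"
      by (simp add: gap_def power_divide power_mult_distrib flip: power_mult)
        (simp add: power_mult mult.commute[of M])
    also have "\<dots> \<le> 8 * x 1 * (4 ^ M / 4 ^ n)"
      using x_le_first[OF n] by (intro mult_right_mono) auto
    finally show ?thesis .
  qed
  have pos: "0 \<le> kernel_term (\<zeta> n) z" if "n \<ge> 1" for n
    using cmod_zero_less[OF that] by (rule kernel_term_nonneg)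
  have head: "(\<Sum>n=1..M. kernel_term (\<zeta> n) z) \<le> ?K * (\<Sum>n=1..M. x n)"
    unfolding sum_distrib_left by (intro sum_mono near) simp
  \<comment> \<open>This absorbs the tail, a multiple of \<open>x 1\<close>, into the main sum; it
    relies on M \<ge> 1.\<close>
  have x1: "x 1 \<le> (\<Sum>n=1..M. x n)"
    using M x_pos by (intro member_le_sum) (auto intro: less_imp_le)
  have "(\<Sum>n=1..k. kernel_term (\<zeta> n) z) \<le> (\<Sum>n=1..max M k. kernel_term (\<zeta> n) z)"
    using pos by (intro sum_mono2) auto
  also have "\<dots> \<le> ?K * (\<Sum>n=1..M. x n) + 8 * x 1 * (1 - 4 ^ M / 4 ^ (max M k))"
  proof -
    \<comment> \<open>The subtracted power makes the bound inductive: with q = 4^M / 4^m, each step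
      adds at most a multiple of q/4, while the right side gains the same multiple of 3q/4.\<close>
    have "(\<Sum>n=1..m. kernel_term (\<zeta> n) z) \<le> ?K * (\<Sum>n=1..M. x n) + 8 * x 1 * (1 - 4 ^ M / 4 ^ m)"
      if "M \<le> m" for m
      using that
    proof (induction m rule: dec_induct)
      case base
      then show ?case using head by simp
    next
      case (step m)
      have "8 * x 1 * (4 ^ M / 4 ^ Suc m) \<le> 8 * x 1 * (4 ^ M / 4 ^ m - 4 ^ M / 4 ^ Suc m)"
        using x_pos[of 1] by (intro mult_left_mono) (auto simp: field_simps)
      then show ?case
        using step far[of "Suc m"] by (simp add: algebra_simps)
    qed
    then show ?thesis by simp
  qed
  also have "8 * x 1 * (1 - 4 ^ M / 4 ^ (max M k)) \<le> 8 * x 1 * 1"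
    using x_pos[of 1] by (intro mult_left_mono) auto
  finally show ?thesis
    using x1 by (simp add: algebra_simps)
qed

end

lemma kernel_norm_square_comparable:
  assumes \<alpha>: "\<alpha> > 1"
  obtains c C where "c > 0" "C > 0"
    "\<And>z M. z \<in> stolz_domain \<alpha> 1 \<Longrightarrow> M \<ge> 1 \<Longrightarrow>
       1 / 2 ^ (M + 1) \<le> 1 - cmod z \<Longrightarrow> 1 - cmod z \<le> 2 / 2 ^ M \<Longrightarrow>
       c * (\<Sum>n=1..M. x n) \<le> (1 - (cmod (tangential_blaschke x z))\<^sup>2) / (1 - (cmod z)\<^sup>2) \<and>
       (1 - (cmod (tangential_blaschke x z))\<^sup>2) / (1 - (cmod z)\<^sup>2) \<le> C * (\<Sum>n=1..M. x n)"
proof -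
  obtain c0 where c0: "c0 > 0" "\<And>n. n \<ge> 1 \<Longrightarrow> c0 / 2 ^ n \<le> cmod (1 - \<zeta> n)"
    using cmod_one_minus_zero_ge by blast
  define C where "C = 8 * \<alpha>\<^sup>2 / c0\<^sup>2 + 8"
  define b where "b = (2 - gap 1) / (2 * \<alpha> + 1 + x 1)\<^sup>2"
  \<comment> \<open>Obtained from 1 - |z|^2 \<le> 4 / 2^M, the upper bound C \<sigma> with \<sigma>
    \<le> M x_1, and M / 2^M \<le> 1.\<close>
  define K where "K = 4 * C * x 1"
  have C: "C > 0" using c0(1) by (simp add: C_def add_nonneg_pos)
  have b: "b > 0"
    using gap_bounds(2)[of 1] \<alpha> x_pos[of 1] by (auto simp: b_def intro!: divide_pos_pos zero_less_power)
  show ?thesis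
  proof (rule that[of "exp (- K) * b" C], goal_cases)
    case (3 z M)
    define \<sigma> where "\<sigma> = (\<Sum>n=1..M. x n)"
    have sums: "(\<Sum>n<k. kernel_term (\<zeta> (Suc n)) z) = (\<Sum>n=1..k. kernel_term (\<zeta> n) z)" for k
      by (simp add: sum.atLeast1_atMost_eq)
    have up: "(\<Sum>n<k. kernel_term (\<zeta> (Suc n)) z) \<le> C * \<sigma>" for k
      unfolding sums \<sigma>_def C_def using sum_kernel_term_le[OF \<alpha> 3(1) c0 3(2) 3(3)] by simp
    have z: "cmod z < 1" using stolz(1)[OF \<alpha> 3(1)] .
    have \<sigma>0: "0 \<le> \<sigma>" unfolding \<sigma>_def using x_pos by (intro sum_nonneg) (auto intro: less_imp_le)
    have lo: "b * \<sigma> \<le> (\<Sum>n<M. kernel_term (\<zeta> (Suc n)) z)"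
      unfolding sums \<sigma>_def sum_distrib_left b_def
      using 3(4) by (intro sum_mono kernel_term_ge[OF \<alpha> 3(1)]) auto
    have "(1 - (cmod z)\<^sup>2) * (\<Sum>n<M. kernel_term (\<zeta> (Suc n)) z) \<le> K"
    proof -
      have "1 - (cmod z)\<^sup>2 = (1 + cmod z) * (1 - cmod z)"
        by (simp add: power2_eq_square algebra_simps)
      also have "\<dots> \<le> 2 * (2 / 2 ^ M)"
        using z 3(4) by (intro mult_mono) auto
      finally have 1: "1 - (cmod z)\<^sup>2 \<le> 4 / 2 ^ M" by simp
      have "\<sigma> \<le> of_nat M * x 1"
        unfolding \<sigma>_def using sum_bounded_above[of "{1..M}" x "x 1"] x_le_first by simp
      then have 2: "C * \<sigma> \<le> C * (real M * x 1)"
        using C by (intro mult_left_mono) auto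
      have "(1 - (cmod z)\<^sup>2) * (\<Sum>n<M. kernel_term (\<zeta> (Suc n)) z) \<le> 4 / 2 ^ M * (C * (real M * x 1))"
        using cmod_zero_less
        by (intro mult_mono 1 order.trans[OF up 2] sum_nonneg kernel_term_nonneg) auto
      also have "\<dots> = K * (real M / 2 ^ M)"
        by (simp add: K_def)
      also have "\<dots> \<le> K * 1"
        using C x_pos[of 1] of_nat_less_two_power[of M, where 'a = real]
        by (intro mult_left_mono) (auto simp: K_def)
      finally show ?thesis by simp
    qed
    from kernel_norm_square_ge[OF blaschke_sequence_zeros z this]
    have "exp (- K) * (\<Sum>n<M. kernel_term (\<zeta> (Suc n)) z) \<le>
      (1 - (cmod (tangential_blaschke x z))\<^sup>2) / (1 - (cmod z)\<^sup>2)"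
      by (simp add: tangential_blaschke_def)
    moreover have "exp (- K) * (b * \<sigma>) \<le> exp (- K) * (\<Sum>n<M. kernel_term (\<zeta> (Suc n)) z)"
      using lo by (intro mult_left_mono) auto
    ultimately have "exp (- K) * (b * \<sigma>) \<le>
        (1 - (cmod (tangential_blaschke x z))\<^sup>2) / (1 - (cmod z)\<^sup>2)"
      by linarith
    then show ?case
      using kernel_norm_square_le[OF blaschke_sequence_zeros z up]
      by (simp add: tangential_blaschke_def \<sigma>_def mult.assoc)
  qed (use C b in auto)
qed

end

section \<open>Interpolation between dyadic scales\<close>

lemma affine_bounds:
  fixes a b t :: real
  assumes "s \<le> t" "t \<le> u" "m \<le> a + b * s" "m \<le> a + b * u" "a + b * s \<le> k" "a + b * u \<le> k"
  shows "m \<le> a + b * t" "a + b * t \<le> k"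
proof -
  have "b * s \<le> b * t \<and> b * t \<le> b * u \<or> b * u \<le> b * t \<and> b * t \<le> b * s"
    using assms(1,2) by (cases "b \<ge> 0") (auto intro: mult_left_mono mult_left_mono_neg)
  then show "m \<le> a + b * t" "a + b * t \<le> k" using assms by auto
qed

lemma affine_interpolation_bounds:
  assumes "affine_interpolation \<phi>0 \<sigma>" "real N \<le> t" "t \<le> real N + 1"
    and "m \<le> \<phi>0 (real N)" "m \<le> \<phi>0 (real (N + 1))" "\<phi>0 (real N) \<le> k" "\<phi>0 (real (N + 1)) \<le> k"
  shows "m \<le> \<phi>0 t \<and> \<phi>0 t \<le> k"
proof -
  obtain a b where ab: "\<forall>t\<in>{real N..real N + 1}. \<phi>0 t = a + b * t"
    using assms(1) unfolding affine_interpolation_def by blast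
  then have "\<phi>0 t = a + b * t" "\<phi>0 (real N) = a + b * real N" "\<phi>0 (real (N + 1)) = a + b * (real N + 1)"
    using assms(2,3) by (auto simp: add.commute)
  then show ?thesis
    using affine_bounds[OF assms(2,3), of m a b k] assms(4-) by simp
qed

lemma dyadic_scale:
  fixes d :: real
  assumes "0 < d" "d \<le> 1"
  obtains N :: nat where "real N \<le> log 2 (1 / d)" "log 2 (1 / d) \<le> real N + 1"
    "1 / 2 ^ (N + 1) \<le> d" "d \<le> 1 / 2 ^ N"
proof -
  define t where "t = log 2 (1 / d)"
  have t: "0 \<le> t" using assms by (simp add: t_def)
  define N where "N = nat \<lfloor>t\<rfloor>"
  have N: "real N \<le> t" "t \<le> real N + 1" using t by (auto simp: N_def)
  have d: "d = 1 / 2 powr t" using assms by (simp add: t_def)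
  have "2 powr real N \<le> 2 powr t" "2 powr t \<le> 2 powr (real N + 1)"
    using N by (auto intro: powr_mono)
  then have "2 ^ N \<le> 2 powr t" "2 powr t \<le> 2 ^ (N + 1)"
    by (auto simp: powr_realpow powr_add)
  then have "1 / 2 ^ (N + 1) \<le> d" "d \<le> 1 / 2 ^ N"
    unfolding d by (auto intro!: divide_left_mono)
  with N show ?thesis using that by (simp add: t_def)
qed

text \<open>Eliminates the intermediate quantity \<open>s\<close>. With \<open>s\<close> a partial
  sum of the x_n, it serves both directions of the comparison between kernel norm and
  \<open>\<phi>\<close>.\<close>

lemma sqrt_comparison:
  assumes "u \<le> C * s" "c * s \<le> v" "c > 0" "C > 0"
  shows "sqrt u \<le> sqrt (C / c) * sqrt v"
proof -
  have "u \<le> C * (v / c)"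
    using assms by (smt (verit) mult_left_mono pos_le_divide_eq mult.commute)
  then show ?thesis by (simp flip: real_sqrt_mult)
qed

theorem theorem3p3:
  fixes x :: "nat \<Rightarrow> real" and \<phi>0 \<phi> :: "real \<Rightarrow> real" and \<sigma> :: "nat \<Rightarrow> real"
    and B :: "complex \<Rightarrow> complex" and \<alpha> :: real
  assumes x_pos: "\<forall>n\<ge>1. x n > 0"
    and x_decreasing: "\<forall>n\<ge>1. x (Suc n) \<le> x n"
    and x_null: "x \<longlonglongrightarrow> 0"
    and zeros_in_disc: "\<forall>n\<ge>1. tangential_zero x n \<in> unit_disc"
    and B_eq: "B = tangential_blaschke x"
    and \<sigma>_eq: "\<forall>N. \<sigma> N = (\<Sum>n=1..N. x n)"
    and \<phi>0: "affine_interpolation \<phi>0 \<sigma>" and \<phi>0_zero: "\<phi>0 0 > 0"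
    and \<phi>_eq: "\<forall>y\<in>{0..<1}. \<phi> y = \<phi>0 (log 2 (1 / (1 - y)))"
    and \<alpha>: "\<alpha> > 1"
  shows "comparable_on (stolz_domain \<alpha> 1)
           (\<lambda>z. H2_norm (model_kernel B z)) (\<lambda>z. sqrt (\<phi> (cmod z)))
       \<and> (\<forall>f \<in> model_space B.
            lesssim_on (stolz_domain \<alpha> 1) (\<lambda>z. cmod (f z)) (\<lambda>z. sqrt (\<phi> (cmod z))))"
proof -
  interpret tangential_zeros x
    by unfold_locales (use x_pos x_decreasing zeros_in_disc in auto)
  have B: "B = blaschke_product (\<lambda>n. tangential_zero x (Suc n))"
    by (simp add: B_eq tangential_blaschke_def)
  obtain c C where c: "c > 0" and C: "C > 0" and kernel:
    "\<And>z M. z \<in> stolz_domain \<alpha> 1 \<Longrightarrow> M \<ge> 1 \<Longrightarrow>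
       1 / 2 ^ (M + 1) \<le> 1 - cmod z \<Longrightarrow> 1 - cmod z \<le> 2 / 2 ^ M \<Longrightarrow>
       c * (\<Sum>n=1..M. x n) \<le> (1 - (cmod (B z))\<^sup>2) / (1 - (cmod z)\<^sup>2) \<and>
       (1 - (cmod (B z))\<^sup>2) / (1 - (cmod z)\<^sup>2) \<le> C * (\<Sum>n=1..M. x n)"
    unfolding B_eq using kernel_norm_square_comparable[OF \<alpha>] by metis
  \<comment> \<open>The ratio compares the free value \<open>\<phi>0 0\<close> with \<sigma>_1 = x_1
    on the first interval. In \<open>P\<close> the entry 2 accounts for \<sigma>_(N+1) \<le> 2
    \<sigma>_N on the later ones.\<close>
  define p where "p = min 1 (\<phi>0 0 / x 1)"
  define P where "P = max 2 (\<phi>0 0 / x 1)"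
  have x1: "x 1 > 0" using x_pos by simp
  have p: "p > 0" and P: "P > 0"
    using x1 \<phi>0_zero by (auto simp: p_def P_def)
  have comparable: "\<exists>s\<ge>0. c * s \<le> (1 - (cmod (B z))\<^sup>2) / (1 - (cmod z)\<^sup>2) \<and>
      (1 - (cmod (B z))\<^sup>2) / (1 - (cmod z)\<^sup>2) \<le> C * s \<and> p * s \<le> \<phi> (cmod z) \<and> \<phi> (cmod z) \<le> P * s"
    if z: "z \<in> stolz_domain \<alpha> 1" for z
  proof -
    have z1: "cmod z < 1" using z by (simp add: stolz_domain_def)
    obtain N where N: "real N \<le> log 2 (1 / (1 - cmod z))" "log 2 (1 / (1 - cmod z)) \<le> real N + 1"
      "1 / 2 ^ (N + 1) \<le> 1 - cmod z" "1 - cmod z \<le> 1 / 2 ^ N"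
      using dyadic_scale[of "1 - cmod z"] z1 by auto
    \<comment> \<open>Replaces the scale 0, where the partial sum is empty. The bound 1 - |z| \<le>
      1 there equals 2 / 2^1, which is why the kernel estimate was stated with
      \<open>2 / 2 ^ M\<close>.\<close>
    define M where "M = max 1 N"
    have "1 / 2 ^ (M + 1) \<le> (1 / 2 ^ (N + 1) :: real)"
      by (intro divide_left_mono power_increasing) (auto simp: M_def)
    moreover have "1 / 2 ^ N \<le> (2 / 2 ^ M :: real)"
      by (cases "N = 0") (auto simp: M_def max_def divide_right_mono)
    ultimately have K: "c * \<sigma> M \<le> (1 - (cmod (B z))\<^sup>2) / (1 - (cmod z)\<^sup>2)"
      "(1 - (cmod (B z))\<^sup>2) / (1 - (cmod z)\<^sup>2) \<le> C * \<sigma> M"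
      using kernel[OF z, of M] N \<sigma>_eq by (auto simp: M_def)
    have \<sigma>1: "\<sigma> 1 = x 1" using \<sigma>_eq by simp
    have s0: "0 \<le> \<sigma> n" for n
      using x_pos \<sigma>_eq by (auto intro!: sum_nonneg simp: less_imp_le)
    have \<sigma>: "\<phi>0 (real n) = \<sigma> n" if "n \<ge> 1" for n
      using \<phi>0 that by (auto simp: affine_interpolation_def)
    have "p * \<sigma> M \<le> \<phi>0 (log 2 (1 / (1 - cmod z))) \<and> \<phi>0 (log 2 (1 / (1 - cmod z))) \<le> P * \<sigma> M"
    proof (rule affine_interpolation_bounds[OF \<phi>0 N(1,2)])
      show "p * \<sigma> M \<le> \<phi>0 (real N)" "\<phi>0 (real N) \<le> P * \<sigma> M"
        "p * \<sigma> M \<le> \<phi>0 (real (N + 1))" "\<phi>0 (real (N + 1)) \<le> P * \<sigma> M"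
      proof -
        have pp: "p * \<sigma> n \<le> \<sigma> n" "2 * \<sigma> n \<le> P * \<sigma> n" for n
          using s0[of n] mult_right_mono[of p 1 "\<sigma> n"] mult_right_mono[of 2 P "\<sigma> n"]
          by (auto simp: p_def P_def)
        have step: "\<sigma> n \<le> \<sigma> (Suc n)" "\<sigma> (Suc n) \<le> 2 * \<sigma> n" if "n \<ge> 1" for n
        proof -
          have S: "\<sigma> (Suc n) = \<sigma> n + x (Suc n)" using \<sigma>_eq by simp
          \<comment> \<open>Doubling follows: the new summand is at most \<open>x 1\<close>, which
            the old sum already contains.\<close>
          have "x 1 \<le> \<sigma> n"
            using \<sigma>_eq x_pos that member_le_sum[of 1 "{1..n}" x] by (auto intro: less_imp_le)
          then show "\<sigma> n \<le> \<sigma> (Suc n)" "\<sigma> (Suc n) \<le> 2 * \<sigma> n"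
            using S x_pos x_le_first[of "Suc n"] by (auto intro: less_imp_le)
        qed
        have zero: "p * x 1 \<le> \<phi>0 0" "\<phi>0 0 \<le> P * x 1"
          using x1 by (auto simp: p_def P_def min_def max_def field_simps)
        show "p * \<sigma> M \<le> \<phi>0 (real N)" "\<phi>0 (real N) \<le> P * \<sigma> M"
          using \<sigma>[of N] pp[of N] zero \<sigma>1 s0[of N] by (cases "N = 0"; simp add: M_def max_def)+
        show "p * \<sigma> M \<le> \<phi>0 (real (N + 1))" "\<phi>0 (real (N + 1)) \<le> P * \<sigma> M"
          using \<sigma>[of "Suc N"] pp[of N] pp[of 1] step[of N] s0[of 1]
          by (cases "N = 0"; simp add: M_def max_def)+
      qed
    qed
    then show ?thesis
      using K s0 \<phi>_eq z1 by (intro exI[of _ "\<sigma> M"]) auto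
  qed
  have norm: "H2_norm (model_kernel B z) = sqrt ((1 - (cmod (B z))\<^sup>2) / (1 - (cmod z)\<^sup>2))"
    if "z \<in> stolz_domain \<alpha> 1" for z
    using H2_norm_model_kernel[OF blaschke_sequence_zeros, of z] that by (simp add: B stolz_domain_def)
  have upper: "H2_norm (model_kernel B z) \<le> sqrt (C / p) * sqrt (\<phi> (cmod z))"
    if "z \<in> stolz_domain \<alpha> 1" for z
    unfolding norm[OF that] using comparable[OF that] sqrt_comparison p C by blast
  have lower: "sqrt (\<phi> (cmod z)) \<le> sqrt (P / c) * H2_norm (model_kernel B z)"
    if "z \<in> stolz_domain \<alpha> 1" for z
    unfolding norm[OF that] using comparable[OF that] sqrt_comparison P c by blast
  have "lesssim_on (stolz_domain \<alpha> 1) (\<lambda>z. cmod (f z)) (\<lambda>z. sqrt (\<phi> (cmod z)))"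
    if f: "f \<in> model_space B" for f
    unfolding lesssim_on_def
  proof (intro exI[of _ "(H2_norm f + 1) * sqrt (C / p)"] conjI ballI)
    have f0: "0 \<le> H2_norm f"
      using f by (intro H2_norm_nonneg) (simp add: model_space_def)
    \<comment> \<open>The summand 1 keeps the constant positive when \<open>f\<close> has norm
      0.\<close>
    then show "0 < (H2_norm f + 1) * sqrt (C / p)" using C p by simp
    fix z assume z: "z \<in> stolz_domain \<alpha> 1"
    then have "cmod z < 1" by (simp add: stolz_domain_def)
    then have "cmod (f z) \<le> H2_norm f * H2_norm (model_kernel B z)"
      using cmod_le_model_kernel_norm[OF blaschke_sequence_zeros] f by (simp add: B)
    also have "\<dots> \<le> (H2_norm f + 1) * (sqrt (C / p) * sqrt (\<phi> (cmod z)))"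
    proof (intro mult_mono upper z)
      show "0 \<le> H2_norm (model_kernel B z)"
        unfolding B by (intro H2_norm_nonneg H2_model_kernel blaschke_sequence_zeros) fact
    qed (use f0 in auto)
    finally show "cmod (f z) \<le> (H2_norm f + 1) * sqrt (C / p) * sqrt (\<phi> (cmod z))"
      by (simp add: mult.assoc)
  qed
  moreover have "comparable_on (stolz_domain \<alpha> 1)
      (\<lambda>z. H2_norm (model_kernel B z)) (\<lambda>z. sqrt (\<phi> (cmod z)))"
    unfolding comparable_on_def lesssim_on_def
    using upper lower p P c C
    by (intro conjI exI[of _ "sqrt (C / p)"] exI[of _ "sqrt (P / c)"]) auto
  ultimately show ?thesis by blast
qed

end
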